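(* Let $\mathcal{G}=(G;T_1,T_2;\theta)\in\mathcal{G}_2^{sym}$ with $\mathcal{G}\neq\mathcal{K}_1$. Then $\mathcal{G}$ has a $\mathcal{C}_s$-realisation in the plane.
   Context: A multi-graph is finite and loop-free, possibly with parallel edges. A $2$-tree decomposition is $(G;T_1,T_2)$ with $G$ a multi-graph and $T_1,T_2$ spanning trees of $G$ whose edge sets partition $E(G)$. Let $\mathbb{Z}_2=\langle s\rangle$. A $\mathbb{Z}_2$-symmetric multi-graph is $(G,\theta)$ with $\theta:\mathbb{Z}_2\to\mathrm{Aut}(G)$ a non-trivial homomorphism; $s_\theta=\theta(s)$, $s_\theta(v_1v_2)=s_\theta(v_1)s_\theta(v_2)$; an edge $e$ is fixed if $s_\theta(e)=e$. A symmetric $2$-tree decomposition is $(G;T_1,T_2;\theta)$ with $(G;T_1,T_2)$ a $2$-tree decomposition, $(G,\theta)$ $\mathbb{Z}_2$-symmetric and $s_\theta(T_i)=T_i$. $\mathcal{G}_2^{sym}$ is the set of symmetric $2$-tree decompositions with no fixed edges, together with $\mathcal{K}_1$ (a single vertex, edgeless trees, trivial $\theta$). Realisations: a framework $(G,p)$ in $\mathbb{R}^d$ is a multi-graph $G$ with an injective $p:V(G)\to\mathbb{R}^d$; $\|x\|_\infty=\max_i|x\cdot e_i|$. If $u,w$ are joined by exactly $t\ge1$ edges, $\{p(u),p(w)\}$ is well-positioned if there are exactly $t$ distinct indices $k$ with $\|p(u)-p(w)\|_\infty=|(p(u)-p(w))\cdot e_k|$ (its framework colours); $(G,p)$ is well-positioned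 if all adjacent pairs are; a framework colouring $\kappa_p$ assigns to the $t$ edges between $u,w$ these $t$ colours bijectively. A realisation of $(G;T_1,\dots,T_d)$ is a well-positioned $(G,p)$ in $\mathbb{R}^d$ with $\kappa_p^{-1}(i)=E(T_i)$ for all $i$, for some framework colouring. A $\mathcal{C}_s$-realisation of a symmetric $2$-tree decomposition $(G;T_1,T_2;\theta)$ is a pair $(p,\tau)$ where $p:V(G)\to\mathbb{R}^2$ is injective, $\tau:\mathbb{Z}_2\to GL(\mathbb{R}^2)$ is a representation with $\tau(s)$ a reflection in a coordinate axis, $\tau(s)(p(v))=p(s_\theta(v))$ for all $v$, and $(G,p)$ is a realisation of $(G;T_1,T_2)$. *)

theory Defs
  imports "HOL-Analysis.Analysis"
begin

text \<open>A finite loop-free multi-graph: vertex set V, edge set E, and an incidence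
  map ends assigning to each edge its two (distinct) end vertices.
  Parallel edges are distinct elements of E with the same ends.\<close>
definition multigraph :: "'v set \<Rightarrow> 'e set \<Rightarrow> ('e \<Rightarrow> 'v set) \<Rightarrow> bool" where
  "multigraph V E ends \<longleftrightarrow> finite V \<and> finite E \<and>
     (\<forall>e\<in>E. ends e \<subseteq> V \<and> card (ends e) = 2)"

definition edges_between :: "'e set \<Rightarrow> ('e \<Rightarrow> 'v set) \<Rightarrow> 'v \<Rightarrow> 'v \<Rightarrow> 'e set" where
  "edges_between E ends u w = {e\<in>E. ends e = {u, w}}"

definition adj_rel :: "'e set \<Rightarrow> ('e \<Rightarrow> 'v set) \<Rightarrow> ('v \<times> 'v) set" where
  "adj_rel F ends = {(u, w). \<exists>e\<in>F. ends e = {u, w}}"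

definition connected_mg :: "'v set \<Rightarrow> 'e set \<Rightarrow> ('e \<Rightarrow> 'v set) \<Rightarrow> bool" where
  "connected_mg V F ends \<longleftrightarrow> (\<forall>u\<in>V. \<forall>w\<in>V. (u, w) \<in> (adj_rel F ends)\<^sup>*)"

text \<open>A tree: a nonempty connected (multi-)graph with |V|-1 edges.\<close>
definition is_tree :: "'v set \<Rightarrow> 'e set \<Rightarrow> ('e \<Rightarrow> 'v set) \<Rightarrow> bool" where
  "is_tree V F ends \<longleftrightarrow> V \<noteq> {} \<and> finite F \<and> connected_mg V F ends \<and> card F + 1 = card V"

definition spanning_tree :: "'v set \<Rightarrow> 'e set \<Rightarrow> ('e \<Rightarrow> 'v set) \<Rightarrow> 'e set \<Rightarrow> bool" where
  "spanning_tree V E ends T \<longleftrightarrow> T \<subseteq> E \<and> is_tree V T ends"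

definition two_tree_decomp ::
  "'v set \<Rightarrow> 'e set \<Rightarrow> ('e \<Rightarrow> 'v set) \<Rightarrow> 'e set \<Rightarrow> 'e set \<Rightarrow> bool" where
  "two_tree_decomp V E ends T1 T2 \<longleftrightarrow> multigraph V E ends \<and>
     spanning_tree V E ends T1 \<and> spanning_tree V E ends T2 \<and>
     T1 \<union> T2 = E \<and> T1 \<inter> T2 = {}"

text \<open>An automorphism of the multigraph: a vertex bijection sV and an edge bijection sE
  compatible with incidence.\<close>
definition mg_automorphism ::
  "'v set \<Rightarrow> 'e set \<Rightarrow> ('e \<Rightarrow> 'v set) \<Rightarrow> ('v \<Rightarrow> 'v) \<Rightarrow> ('e \<Rightarrow> 'e) \<Rightarrow> bool" where
  "mg_automorphism V E ends sV sE \<longleftrightarrow> bij_betw sV V V \<and> bij_betw sE E E \<and>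
     (\<forall>e\<in>E. ends (sE e) = sV ` ends e)"

text \<open>A non-trivial homomorphism Z2 -> Aut(G) is determined by the image (sV, sE) of the
  generator s: an automorphism which is an involution and not the identity.\<close>
definition Z2_symmetric ::
  "'v set \<Rightarrow> 'e set \<Rightarrow> ('e \<Rightarrow> 'v set) \<Rightarrow> ('v \<Rightarrow> 'v) \<Rightarrow> ('e \<Rightarrow> 'e) \<Rightarrow> bool" where
  "Z2_symmetric V E ends sV sE \<longleftrightarrow> multigraph V E ends \<and> mg_automorphism V E ends sV sE \<and>
     (\<forall>v\<in>V. sV (sV v) = v) \<and> (\<forall>e\<in>E. sE (sE e) = e) \<and>
     \<not> ((\<forall>v\<in>V. sV v = v) \<and> (\<forall>e\<in>E. sE e = e))"

definition sym_two_tree_decomp ::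
  "'v set \<Rightarrow> 'e set \<Rightarrow> ('e \<Rightarrow> 'v set) \<Rightarrow> 'e set \<Rightarrow> 'e set \<Rightarrow> ('v \<Rightarrow> 'v) \<Rightarrow> ('e \<Rightarrow> 'e) \<Rightarrow> bool" where
  "sym_two_tree_decomp V E ends T1 T2 sV sE \<longleftrightarrow> two_tree_decomp V E ends T1 T2 \<and>
     Z2_symmetric V E ends sV sE \<and> sE ` T1 = T1 \<and> sE ` T2 = T2"

text \<open>K1: a single vertex, no edges, edgeless trees, trivial action.\<close>
definition is_K1 ::
  "'v set \<Rightarrow> 'e set \<Rightarrow> ('e \<Rightarrow> 'v set) \<Rightarrow> 'e set \<Rightarrow> 'e set \<Rightarrow> ('v \<Rightarrow> 'v) \<Rightarrow> ('e \<Rightarrow> 'e) \<Rightarrow> bool" where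
  "is_K1 V E ends T1 T2 sV sE \<longleftrightarrow> card V = 1 \<and> E = {} \<and> T1 = {} \<and> T2 = {} \<and>
     (\<forall>v\<in>V. sV v = v)"

definition in_G2sym ::
  "'v set \<Rightarrow> 'e set \<Rightarrow> ('e \<Rightarrow> 'v set) \<Rightarrow> 'e set \<Rightarrow> 'e set \<Rightarrow> ('v \<Rightarrow> 'v) \<Rightarrow> ('e \<Rightarrow> 'e) \<Rightarrow> bool" where
  "in_G2sym V E ends T1 T2 sV sE \<longleftrightarrow>
     (sym_two_tree_decomp V E ends T1 T2 sV sE \<and> (\<forall>e\<in>E. sE e \<noteq> e))
     \<or> is_K1 V E ends T1 T2 sV sE"

section \<open>Frameworks in the plane (real^2, colours = coordinate indices of type 2)\<close>

text \<open>Framework colours of the pair {x, y}: indices k attaining the l-infinity norm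
  of x - y (infnorm is the library l-infinity norm).\<close>
definition framework_colours :: "real^2 \<Rightarrow> real^2 \<Rightarrow> 2 set" where
  "framework_colours x y = {k. infnorm (x - y) = \<bar>(x - y) \<bullet> axis k 1\<bar>}"

definition well_positioned ::
  "'v set \<Rightarrow> 'e set \<Rightarrow> ('e \<Rightarrow> 'v set) \<Rightarrow> ('v \<Rightarrow> real^2) \<Rightarrow> bool" where
  "well_positioned V E ends p \<longleftrightarrow>
     (\<forall>u\<in>V. \<forall>w\<in>V. edges_between E ends u w \<noteq> {} \<longrightarrow>
        card (framework_colours (p u) (p w)) = card (edges_between E ends u w))"

definition framework_colouring ::
  "'v set \<Rightarrow> 'e set \<Rightarrow> ('e \<Rightarrow> 'v set) \<Rightarrow> ('v \<Rightarrow> real^2) \<Rightarrow> ('e \<Rightarrow> 2) \<Rightarrow> bool" where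
  "framework_colouring V E ends p \<kappa> \<longleftrightarrow>
     (\<forall>u\<in>V. \<forall>w\<in>V. edges_between E ends u w \<noteq> {} \<longrightarrow>
        bij_betw \<kappa> (edges_between E ends u w) (framework_colours (p u) (p w)))"

text \<open>Realisation of (G;T1,T2): a well-positioned framework (injective p) with a framework
  colouring whose colour classes are T1 (colour 1) and T2 (colour 2).\<close>
definition realisation ::
  "'v set \<Rightarrow> 'e set \<Rightarrow> ('e \<Rightarrow> 'v set) \<Rightarrow> 'e set \<Rightarrow> 'e set \<Rightarrow> ('v \<Rightarrow> real^2) \<Rightarrow> bool" where
  "realisation V E ends T1 T2 p \<longleftrightarrow> inj_on p V \<and> well_positioned V E ends p \<and>
     (\<exists>\<kappa>. framework_colouring V E ends p \<kappa> \<and>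
          {e\<in>E. \<kappa> e = 1} = T1 \<and> {e\<in>E. \<kappa> e = 2} = T2)"

text \<open>tau(s) is the reflection in a coordinate axis: negates exactly one coordinate.\<close>
definition coord_axis_reflection :: "(real^2 \<Rightarrow> real^2) \<Rightarrow> bool" where
  "coord_axis_reflection \<tau> \<longleftrightarrow>
     (\<exists>k::2. \<forall>x. \<tau> x = (\<chi> j. if j = k then - (x $ j) else x $ j))"

definition Cs_realisation ::
  "'v set \<Rightarrow> 'e set \<Rightarrow> ('e \<Rightarrow> 'v set) \<Rightarrow> 'e set \<Rightarrow> 'e set \<Rightarrow> ('v \<Rightarrow> 'v)
     \<Rightarrow> ('v \<Rightarrow> real^2) \<Rightarrow> (real^2 \<Rightarrow> real^2) \<Rightarrow> bool" where
  "Cs_realisation V E ends T1 T2 sV p \<tau> \<longleftrightarrow> inj_on p V \<and> coord_axis_reflection \<tau> \<and>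
     (\<forall>v\<in>V. \<tau> (p v) = p (sV v)) \<and> realisation V E ends T1 T2 p"

end

(* After a rotation by 45 degrees the sup-norm colour of an edge vw is the sign of the product of
   the two coordinate differences, and the reflection interchanges the coordinates. A symmetric
   placement is therefore one real function u on the vertices, with v placed at (u v, u (s v)), and
   the requirement is (u v - u w) * (u (s v) - u (s w)) > 0 for edges of T2 only, < 0 for edges of T1
   only, and = 0 for parallel edges. Since each parallel pair must be aligned in exactly one of the
   two coordinates, one half F of every orbit of parallel pairs may be prescribed to satisfy
   u v = u w; the induction needs this for every choice of F, with u otherwise injective.

   Counting edges of the quotient tree shows that s has at most one fixed vertex, so some vertex a
   with s a distinct from a has degree (1,1), (1,2) or (2,1) in the two trees. Remove a and s a,
   joining the two neighbours of a in the tree where a has degree 2. The vertices a and s a can be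
   put back because u a and u (s a) are independent. *)
theory Submission
  imports Defs
begin

section \<open>Trees as sets of vertex pairs\<close>

definition link :: "'v set set \<Rightarrow> ('v \<times> 'v) set" where
  "link F = (adj_rel F (\<lambda>e. e))\<^sup>*"

lemma link_refl [simp]: "(x, x) \<in> link F"
  by (simp add: link_def)

lemma link_edge: "{x, y} \<in> F \<Longrightarrow> (x, y) \<in> link F"
  by (auto simp: link_def adj_rel_def)

lemma link_trans: "(x, y) \<in> link F \<Longrightarrow> (y, z) \<in> link F \<Longrightarrow> (x, z) \<in> link F"
  by (auto simp: link_def)

lemma link_sym: "(x, y) \<in> link F \<Longrightarrow> (y, x) \<in> link F"
proof -
  have "sym (adj_rel F (\<lambda>e. e))" by (auto simp: sym_def adj_rel_def insert_commute)
  then show "(x, y) \<in> link F \<Longrightarrow> (y, x) \<in> link F"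
    unfolding link_def by (meson sym_rtrancl symD)
qed

lemma link_mono: "(x, y) \<in> link F \<Longrightarrow> F \<subseteq> F' \<Longrightarrow> (x, y) \<in> link F'"
  unfolding link_def by (erule rtrancl_mono[THEN subsetD, rotated]) (auto simp: adj_rel_def)

lemma link_induct [consumes 1, case_names refl step]:
  assumes "(x, y) \<in> link F" "P x"
    "\<And>y z. (x, y) \<in> link F \<Longrightarrow> {y, z} \<in> F \<Longrightarrow> P y \<Longrightarrow> P z"
  shows "P y"
  using assms(1) unfolding link_def
  by (induction rule: rtrancl_induct) (use assms(2,3) in \<open>auto simp: adj_rel_def link_def\<close>)

lemma link_const:
  assumes "(x, y) \<in> link F" "\<And>x y. {x, y} \<in> F \<Longrightarrow> f x = f y"
  shows "f x = f y"
  using assms(1) by (induction rule: link_induct) (use assms(2) in auto)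

lemma link_empty [simp]: "(x, y) \<in> link {} \<longleftrightarrow> x = y"
  using link_const[of x y "{}" "\<lambda>x. x"] by auto

lemma link_isolated:
  assumes "(x, y) \<in> link F" "\<And>e. e \<in> F \<Longrightarrow> y \<notin> e"
  shows "x = y"
  using link_sym[OF assms(1)]
  by (induction rule: link_induct) (use assms(2) in auto)

text \<open>A walk can be shortened until it crosses the new pair at most once, in one of two
  directions. Later surgery on trees rests on this case distinction.\<close>

lemma link_insert:
  "(x, y) \<in> link (insert {c, d} F) \<longleftrightarrow> (x, y) \<in> link F \<or>
     (x, c) \<in> link F \<and> (d, y) \<in> link F \<or> (x, d) \<in> link F \<and> (c, y) \<in> link F"
  (is "?L \<longleftrightarrow> ?R x y")
proof
  assume ?L
  then show "?R x y"
  proof (induction rule: link_induct)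
    case (step y z)
    show ?case
    proof (cases "{y, z} = {c, d}")
      case True
      then show ?thesis using step(3) link_sym by (force simp: doubleton_eq_iff)
    next
      case False
      then have "(y, z) \<in> link F" using step(2) link_edge[of y z F] by auto
      then show ?thesis using step(3) link_trans[of _ y F z] by blast
    qed
  qed simp
next
  have cd: "(c, d) \<in> link (insert {c, d} F)" by (simp add: link_edge)
  note mono = link_mono[OF _ subset_insertI, of _ _ F "{c, d}"]
  assume "?R x y"
  then show ?L
    using link_trans[OF link_trans[OF mono cd] mono] link_trans[OF link_trans[OF mono link_sym[OF cd]] mono]
      mono[of x y] by blast
qed

lemma link_image:
  assumes "\<And>x. s (s x) = x"
  shows "(x, y) \<in> link ((`) s ` F) \<longleftrightarrow> (s x, s y) \<in> link F"
proof -
  have *: "(x, y) \<in> link F \<Longrightarrow> (s x, s y) \<in> link ((`) s ` F)" for x y F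
  proof (induction rule: link_induct)
    case (step y z)
    have "{s y, s z} \<in> (`) s ` F" using step(2) by (intro image_eqI[of _ _ "{y, z}"]) auto
    then show ?case using link_trans[OF step(3) link_edge] by blast
  qed simp
  have "(`) s ` (`) s ` F = F" by (simp add: image_image assms)
  then show ?thesis using *[of "s x" "s y" F] *[of x y "(`) s ` F"] assms by auto
qed

text \<open>Every edge lowers the number of connected components by at most one; the components
  are tracked through a set of pairwise unlinked representatives.\<close>
lemma unlinked_representatives:
  assumes "finite F" "finite V" "\<And>e. e \<in> F \<Longrightarrow> \<exists>x y. e = {x, y}"
  shows "\<exists>R\<subseteq>V. card V \<le> card R + card F \<and> (\<forall>x\<in>R. \<forall>y\<in>R. (x, y) \<in> link F \<longrightarrow> x = y)"
  using assms(1,3)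
proof (induction rule: finite_induct)
  case empty
  show ?case by (rule exI[of _ V]) auto
next
  case (insert f F)
  obtain R where R: "R \<subseteq> V" "card V \<le> card R + card F"
    "\<And>x y. x \<in> R \<Longrightarrow> y \<in> R \<Longrightarrow> (x, y) \<in> link F \<Longrightarrow> x = y"
    using insert.IH[OF insert.prems[OF insertI2]] by metis
  obtain c d where f: "f = {c, d}" using insert.prems[OF insertI1] by metis
  show ?case
  proof (cases "\<exists>r\<in>R. (r, c) \<in> link F")
    case True
    then obtain r where r: "r \<in> R" "(r, c) \<in> link F" by blast
    have fR: "finite R" using R(1) assms(2) finite_subset by blast
    \<comment> \<open>Only \<open>r\<close> can reach \<open>c\<close>, since representatives are
      unlinked. Once it is dropped, no walk between representatives crosses the new pair.\<close>
    have "card V \<le> card (R - {r}) + card (insert f F)"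
      using R(2) r(1) fR insert.hyps by (simp add: card_Diff_singleton)
    moreover have "x = y" if "x \<in> R - {r}" "y \<in> R - {r}" "(x, y) \<in> link (insert f F)" for x y
    proof -
      have "(x, y) \<in> link F \<or> (x, c) \<in> link F \<or> (c, y) \<in> link F"
        using that(3) unfolding f link_insert by blast
      moreover have "(x, c) \<notin> link F" if "x \<in> R - {r}" for x
        using that R(3)[of x r] r link_trans[OF _ link_sym[OF r(2)]] by blast
      ultimately show ?thesis using that(1,2) R(3)[of x y] link_sym[of c y F] by blast
    qed
    ultimately show ?thesis using R(1) by (intro exI[of _ "R - {r}"]) auto
  next
    case False
    then have "x = y" if "x \<in> R" "y \<in> R" "(x, y) \<in> link (insert f F)" for x y
      using that R(3)[of x y] link_sym[of c y F] unfolding f link_insert by blast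
    then show ?thesis using R insert.hyps by (intro exI[of _ R]) auto
  qed
qed

text \<open>If all vertices are linked, at most one representative survives.\<close>

lemma linked_card_le:
  assumes "finite F" "finite V" "\<And>e. e \<in> F \<Longrightarrow> \<exists>x y. e = {x, y}"
    and "\<And>x y. x \<in> V \<Longrightarrow> y \<in> V \<Longrightarrow> (x, y) \<in> link F"
  shows "card V \<le> card F + 1"
proof -
  obtain R where R: "R \<subseteq> V" "card V \<le> card R + card F"
    "\<forall>x\<in>R. \<forall>y\<in>R. (x, y) \<in> link F \<longrightarrow> x = y"
    using unlinked_representatives[OF assms(1-3)] by blast
  then have "card R \<le> 1"
    using assms(2,4) finite_subset by (metis One_nat_def card_le_Suc0_iff_eq subsetD)
  then show ?thesis using R(2) by simp
qed

text \<open>A tree has no parallel edges, so each edge may be replaced by the set of its ends. A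
  parallel pair of the multi-graph then becomes a common element of the two trees.\<close>

definition pair_tree :: "'v set \<Rightarrow> 'v set set \<Rightarrow> bool" where
  "pair_tree V T \<longleftrightarrow> finite V \<and> (\<forall>e\<in>T. e \<subseteq> V \<and> card e = 2) \<and>
     (\<forall>x\<in>V. \<forall>y\<in>V. (x, y) \<in> link T) \<and> card T + 1 = card V"

lemma pair_treeD:
  assumes "pair_tree V T"
  shows "finite V" "\<And>e. e \<in> T \<Longrightarrow> e \<subseteq> V" "\<And>e. e \<in> T \<Longrightarrow> card e = 2"
    "\<And>x y. x \<in> V \<Longrightarrow> y \<in> V \<Longrightarrow> (x, y) \<in> link T" "card T + 1 = card V" "finite T"
    "\<And>x y. {x, y} \<in> T \<Longrightarrow> x \<noteq> y \<and> x \<in> V \<and> y \<in> V" "\<And>e. e \<in> T \<Longrightarrow> \<exists>x y. e = {x, y}"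
proof -
  show 1: "finite V" "\<And>e. e \<in> T \<Longrightarrow> e \<subseteq> V" "\<And>e. e \<in> T \<Longrightarrow> card e = 2"
    "\<And>x y. x \<in> V \<Longrightarrow> y \<in> V \<Longrightarrow> (x, y) \<in> link T" "card T + 1 = card V"
    using assms by (auto simp: pair_tree_def)
  show "finite T" using 1(1,2) by (intro finite_subset[of T "Pow V"]) auto
  show "x \<noteq> y \<and> x \<in> V \<and> y \<in> V" if "{x, y} \<in> T" for x y
    using 1(2,3)[OF that] by (auto simp: card_2_iff)
  show "\<exists>x y. e = {x, y}" if "e \<in> T" for e
    using 1(3)[OF that] by (auto simp: card_2_iff)
qed

text \<open>If the ends stayed linked, deleting the edge would leave a connected graph with too few
  edges.\<close>

lemma pair_tree_bridge:
  assumes "pair_tree V T" "{c, d} \<in> T"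
  shows "(c, d) \<notin> link (T - {{c, d}})"
proof
  note t = pair_treeD[OF assms(1)]
  let ?T = "T - {{c, d}}"
  assume *: "(c, d) \<in> link ?T"
  have T: "insert {c, d} ?T = T" using assms(2) by blast
  have "(x, y) \<in> link ?T" if "x \<in> V" "y \<in> V" for x y
  proof -
    have "(x, y) \<in> link (insert {c, d} ?T)" using t(4)[OF that] T by simp
    then show ?thesis
      using link_trans[OF link_trans[OF _ *]] link_trans[OF link_trans[OF _ link_sym[OF *]]]
      unfolding link_insert by blast
  qed
  then have "card V \<le> card ?T + 1"
    using t(1,6,8) by (intro linked_card_le) auto
  moreover have "card T \<noteq> 0" using assms(2) t(6) by auto
  ultimately show False using t(5,6) assms(2) by simp
qed

text \<open>Two edge-disjoint walks from \<open>b\<close> to \<open>c\<close> would close a cycle: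
  if the first one crosses an edge, the second links the ends of that edge around it, contradicting
  \<open>pair_tree_bridge\<close>.\<close>

lemma pair_tree_disjoint_links:
  assumes "pair_tree V T" "F \<subseteq> T" "H \<subseteq> T" "F \<inter> H = {}"
    and "(b, c) \<in> link F" "(b, c) \<in> link H"
  shows "b = c"
proof -
  have "finite F" using assms(1,2) pair_treeD(6) finite_subset by blast
  then show ?thesis using assms(2,4,5)
  proof (induction rule: finite_induct)
    case (insert f F)
    obtain x y where f: "f = {x, y}" using insert.prems pair_treeD(3)[OF assms(1)]
      by (metis card_2_iff insert_subset)
    have "F \<subseteq> T - {f}" "H \<subseteq> T - {f}" using insert assms(3) by auto
    note mono = link_mono[OF _ this(1)] link_mono[OF _ this(2)]
    have "(x, y) \<notin> link (T - {f})"
      using pair_tree_bridge[OF assms(1)] insert.prems f by blast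
    moreover have "(x, y) \<in> link (T - {f})" if "(b, x) \<in> link F" "(y, c) \<in> link F" for x y
      using link_trans[OF link_trans[OF link_sym[OF mono(1)[OF that(1)]] mono(2)[OF assms(6)]]
          link_sym[OF mono(1)[OF that(2)]]] .
    ultimately have "(b, c) \<in> link F"
      using insert.prems(3) link_sym[of y x] unfolding f link_insert by blast
    then show ?case using insert by auto
  qed simp
qed

text \<open>Without its only edge \<open>a\<close> is isolated, so a walk between other vertices
  never needs that edge.\<close>

lemma pair_tree_delete_leaf:
  assumes "pair_tree V T" "a \<in> V" "{e \<in> T. a \<in> e} = {{a, b}}"
  shows "pair_tree (V - {a}) {e \<in> T. a \<notin> e}"
proof -
  note t = pair_treeD[OF assms(1)]
  let ?T = "{e \<in> T. a \<notin> e}"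
  have T: "T = insert {a, b} ?T" using assms(3) by blast
  have "card (insert {a, b} ?T) = card ?T + 1" using t(6) by simp
  then have "card ?T + 1 = card (V - {a})"
    using T t(1,5) assms(2) by (simp add: card_Diff_singleton)
  moreover have "(x, y) \<in> link ?T" if "x \<in> V - {a}" "y \<in> V - {a}" for x y
  proof -
    have "(x, y) \<in> link (insert {a, b} ?T)" using t(4) that T by auto
    then show ?thesis using link_isolated[of x a ?T] link_isolated[OF link_sym, of a y ?T] that
      unfolding link_insert by blast
  qed
  moreover have "e \<subseteq> V - {a}" if "e \<in> ?T" for e using t(2) that by blast
  ultimately show ?thesis unfolding pair_tree_def using t(1,3) by blast
qed

text \<open>The pair \<open>{c, d}\<close> would close a triangle, so it is new to the tree; it
  replaces every passage through \<open>a\<close>.\<close>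

lemma pair_tree_suppress:
  assumes "pair_tree V T" "a \<in> V" "{e \<in> T. a \<in> e} = {{a, c}, {a, d}}" "c \<noteq> d"
  shows "{c, d} \<notin> T" "pair_tree (V - {a}) (insert {c, d} {e \<in> T. a \<notin> e})"
proof -
  note t = pair_treeD[OF assms(1)]
  let ?T = "{e \<in> T. a \<notin> e}"
  have ac: "{a, c} \<in> T" "{a, d} \<in> T" using assms(3) by auto
  then have ne: "a \<noteq> c" "a \<noteq> d" "c \<in> V" "d \<in> V" using t(7) by blast+
  show cd: "{c, d} \<notin> T"
  proof
    assume "{c, d} \<in> T"
    have "{a, c} \<in> T - {{c, d}}" "{a, d} \<in> T - {{c, d}}"
      using ac ne assms(4) by (auto simp: doubleton_eq_iff)
    then have "(c, d) \<in> link (T - {{c, d}})"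
      by (meson link_trans[OF link_sym[OF link_edge] link_edge, of a c _ d])
    then show False using pair_tree_bridge[OF assms(1) \<open>{c, d} \<in> T\<close>] by blast
  qed
  have T: "T = insert {a, c} (insert {a, d} ?T)" using assms(3) by blast
  have "{a, c} \<notin> insert {a, d} ?T" using assms(4) by (auto simp: doubleton_eq_iff)
  then have "card (insert {a, c} (insert {a, d} ?T)) = card ?T + 2" using t(6) by simp
  then have "card T = card ?T + 2" using T by simp
  then have "card (insert {c, d} ?T) + 1 = card (V - {a})"
    using cd t(1,5,6) assms(2) by (simp add: card_Diff_singleton)
  moreover have "(x, y) \<in> link (insert {c, d} ?T)" if "x \<in> V - {a}" "y \<in> V - {a}" for x y
  proof -
    have "(x, y) \<in> link (insert {a, c} (insert {a, d} ?T))" using t(4) that T by auto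
    then show ?thesis
      using link_isolated[of x a ?T] link_isolated[OF link_sym, of a y ?T] link_isolated[of d a ?T]
        link_isolated[OF link_sym, of a d ?T] link_isolated[of c a ?T]
        link_isolated[OF link_sym, of a c ?T] that ne
      unfolding link_insert by blast
  qed
  moreover have "e \<subseteq> V - {a} \<and> card e = 2" if "e \<in> insert {c, d} ?T" for e
    using t(2,3) that ne assms(4) by auto
  ultimately show "pair_tree (V - {a}) (insert {c, d} ?T)"
    unfolding pair_tree_def using t(1) by blast
qed

text \<open>Orbits have exactly two points, so they can be split one at a time. This serves both the
  quotient of a tree and the choice of a half of the parallel pairs.\<close>

lemma involution_transversal:
  assumes "finite X" "\<And>x. x \<in> X \<Longrightarrow> f x \<in> X \<and> f x \<noteq> x \<and> f (f x) = x"
  shows "\<exists>H. H \<union> f ` H = X \<and> H \<inter> f ` H = {}"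
  using assms
proof (induction rule: finite_psubset_induct)
  case (psubset X)
  show ?case
  proof (cases "X = {}")
    case False
    then obtain x where x: "x \<in> X" by blast
    note fx = psubset.prems[OF x]
    have "f y \<in> X - {x, f x} \<and> f y \<noteq> y \<and> f (f y) = y" if "y \<in> X - {x, f x}" for y
      using psubset.prems[of y] fx that by auto
    moreover have "X - {x, f x} \<subset> X" using x by blast
    ultimately obtain H where H: "H \<union> f ` H = X - {x, f x}" "H \<inter> f ` H = {}"
      using psubset.IH[of "X - {x, f x}"] by meson
    have "insert x H \<union> f ` insert x H = X" using H(1) x fx by auto
    moreover have "insert x H \<inter> f ` insert x H = {}" using H fx by auto
    ultimately show ?thesis by blast
  qed auto
qed

section \<open>Trees with an involution\<close>

text \<open>The involution acts on the whole type, so that its equations need no membership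
  premises. In the application it is the identity outside the vertex set.\<close>

locale involution =
  fixes s :: "'v \<Rightarrow> 'v"
  assumes s_s [simp]: "s (s x) = x"
begin

lemma s_eq_iff [simp]: "s x = s y \<longleftrightarrow> x = y"
  by (metis s_s)

lemma image_s_s [simp]: "s ` s ` e = e"
  by (simp add: image_image)

lemma mem_image_s: "x \<in> s ` e \<longleftrightarrow> s x \<in> e"
  by (metis image_iff s_s)

lemma inj_image_s: "inj_on ((`) s) A"
  by (metis image_s_s inj_on_def)

definition sym_tree :: "'v set \<Rightarrow> 'v set set \<Rightarrow> bool" where
  "sym_tree V T \<longleftrightarrow> pair_tree V T \<and> (\<forall>v\<in>V. s v \<in> V) \<and> (\<forall>e\<in>T. s ` e \<in> T \<and> s ` e \<noteq> e)"

lemma sym_treeD: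
  assumes "sym_tree V T"
  shows "pair_tree V T" "\<And>v. v \<in> V \<Longrightarrow> s v \<in> V" "\<And>e. e \<in> T \<Longrightarrow> s ` e \<in> T"
    "\<And>e. e \<in> T \<Longrightarrow> s ` e \<noteq> e" "\<And>x y. {x, y} \<in> T \<Longrightarrow> {s x, s y} \<in> T"
    "\<And>x y. {x, y} \<in> T \<Longrightarrow> y \<noteq> s x"
proof -
  show *: "pair_tree V T" "\<And>v. v \<in> V \<Longrightarrow> s v \<in> V" "\<And>e. e \<in> T \<Longrightarrow> s ` e \<in> T"
    "\<And>e. e \<in> T \<Longrightarrow> s ` e \<noteq> e"
    using assms by (auto simp: sym_tree_def)
  show "{s x, s y} \<in> T" if "{x, y} \<in> T" for x y using *(3)[OF that] by simp
  show "y \<noteq> s x" if "{x, y} \<in> T" for x y using *(4)[OF that] by auto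
qed

text \<open>\<open>F\<close> contains exactly one edge of each \<open>s\<close>-orbit of \<open>D\<close>.\<close>
definition half :: "'v set set \<Rightarrow> 'v set set \<Rightarrow> bool" where
  "half F D \<longleftrightarrow> F \<union> (`) s ` F = D \<and> F \<inter> (`) s ` F = {}"

text \<open>The quotient graph is connected with half as many edges as \<open>T\<close>, so it has few vertices.\<close>
lemma sym_tree_fixed_unique:
  assumes "sym_tree V T" "x \<in> V" "y \<in> V" "s x = x" "s y = y"
  shows "x = y"
proof (rule ccontr)
  assume "x \<noteq> y"
  note st = sym_treeD[OF assms(1)] and t = pair_treeD[OF sym_treeD(1)[OF assms(1)]]
  obtain H where H: "H \<union> (`) s ` H = T" "H \<inter> (`) s ` H = {}"
    using involution_transversal[OF t(6), of "(`) s"] st by auto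
  have fH: "finite H" using H(1) t(6) finite_subset by blast
  have card_T: "card T = 2 * card H"
    unfolding H(1)[symmetric] using H(2) fH card_image[OF inj_image_s, of H]
    by (simp add: card_Un_disjoint)
  \<comment> \<open>The quotient map: \<open>q v\<close> is the orbit of \<open>v\<close>, and the
    edges in \<open>H\<close> represent all edges of the quotient.\<close>
  define q where "q v = {v, s v}" for v
  have q_s: "q (s v) = q v" for v by (auto simp: q_def)
  let ?H = "(`) q ` H"
  have "(q u, q w) \<in> link ?H" if "u \<in> V" "w \<in> V" for u w
    using t(4)[OF that]
  proof (induction rule: link_induct)
    case (step y z)
    have "{q y, q z} \<in> ?H"
    proof (cases "{y, z} \<in> H")
      case True
      then show ?thesis by (intro image_eqI[of _ _ "{y, z}"]) auto
    next
      case False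
      then obtain e where "e \<in> H" "{y, z} = s ` e" using step(2) H(1) by blast
      moreover from this have "q ` e = {q y, q z}"
        using q_s by (metis image_empty image_image image_insert image_cong)
      ultimately show ?thesis by auto
    qed
    then show ?case using link_trans[OF step(3) link_edge] by blast
  qed simp
  moreover have "\<exists>x y. e = {x, y}" if e: "e \<in> ?H" for e
  proof -
    obtain f where f: "f \<in> H" "e = q ` f" using e by blast
    then have "f \<in> T" using H(1) by blast
    then show ?thesis using t(8)[of f] f(2) by (metis image_empty image_insert)
  qed
  ultimately have "card (q ` V) \<le> card ?H + 1"
    using fH t(1) by (intro linked_card_le) auto
  then have 1: "card (q ` V) \<le> card H + 1" using card_image_le[OF fH, of "(`) q"] by linarith
  have qxy: "q x \<in> q ` V" "q y \<in> q ` V" "q x \<noteq> q y" "q x = {x}" "q y = {y}"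
    using assms \<open>x \<noteq> y\<close> by (auto simp: q_def)
  \<comment> \<open>The orbits of \<open>x\<close> and \<open>y\<close> contain one vertex each and
    all others at most two. Hence \<open>card V\<close> is at most twice the number of orbits minus
    2, thus at most \<open>2 * card H = card T\<close>, which is one too few.\<close>
  let ?Q = "q ` V - {q x, q y}"
  have "V - {x, y} \<subseteq> \<Union>?Q"
    using assms(4,5) by (auto simp: q_def doubleton_eq_iff)
  then have "card (V - {x, y}) \<le> card (\<Union>?Q)"
    using t(1) by (intro card_mono) (auto simp: q_def)
  also have "\<dots> \<le> sum card ?Q" by (rule card_Union_le_sum_card)
  also have "\<dots> \<le> of_nat (card ?Q) * 2"
  proof (rule sum_bounded_above)
    fix i assume "i \<in> ?Q"
    then obtain v where "i = {v, s v}" by (auto simp: q_def)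
    then show "card i \<le> 2" using card_length[of "[v, s v]"] by (simp add: numeral_2_eq_2)
  qed
  finally have "card (V - {x, y}) \<le> 2 * card ?Q" by simp
  moreover have "card ?Q + 2 = card (q ` V)"
    using qxy(1-3) t(1) card_Diff_subset[of "{q x, q y}" "q ` V"] card_mono[of "q ` V" "{q x, q y}"]
    by auto
  moreover have "card (V - {x, y}) + 2 = card V"
    using assms(2,3) \<open>x \<noteq> y\<close> t(1) card_Diff_subset[of "{x, y}" V] card_mono[of V "{x, y}"]
    by auto
  ultimately show False using 1 card_T t(5) by linarith
qed

section \<open>Removing a vertex together with its mirror image\<close>

definition away :: "'v \<Rightarrow> 'v set set \<Rightarrow> 'v set set" where
  "away a T = {e \<in> T. a \<notin> e \<and> s a \<notin> e}"

lemma sym_tree_star_image: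
  assumes "sym_tree V T"
  shows "{e \<in> T. s a \<in> e} = (`) s ` {e \<in> T. a \<in> e}"
proof (intro equalityI subsetI)
  fix e assume "e \<in> {e \<in> T. s a \<in> e}"
  then have "s ` e \<in> {e \<in> T. a \<in> e}" using sym_treeD(3)[OF assms] by (auto simp: mem_image_s)
  then show "e \<in> (`) s ` {e \<in> T. a \<in> e}" by (metis image_eqI image_s_s)
next
  fix e assume "e \<in> (`) s ` {e \<in> T. a \<in> e}"
  then show "e \<in> {e \<in> T. s a \<in> e}" using sym_treeD(3)[OF assms] by auto
qed

text \<open>No edge joins \<open>a\<close> to \<open>s a\<close>, since such an edge would be fixed.
  So the edge at \<open>s a\<close> survives the removal of \<open>a\<close>, and the two leaves are
  deleted in turn.\<close>

lemma sym_tree_delete_leaf: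
  assumes "sym_tree V T" "a \<in> V" "s a \<noteq> a" "{e \<in> T. a \<in> e} = {{a, b}}"
  shows "sym_tree (V - {a, s a}) (away a T)"
proof -
  note st = sym_treeD[OF assms(1)]
  let ?T = "{e \<in> T. a \<notin> e}"
  have "{a, b} \<in> T" using assms(4) by blast
  then have "b \<noteq> s a" using st(6) by blast
  then have "{e \<in> {{s a, s b}}. a \<notin> e} = {{s a, s b}}" using assms(3) by auto
  moreover have "{e \<in> T. s a \<in> e} = {{s a, s b}}"
    using sym_tree_star_image[OF assms(1), of a] assms(4) by simp
  then have "{e \<in> ?T. s a \<in> e} = {e \<in> {{s a, s b}}. a \<notin> e}" by blast
  ultimately have "{e \<in> ?T. s a \<in> e} = {{s a, s b}}" by (rule trans[rotated])
  from pair_tree_delete_leaf[OF pair_tree_delete_leaf[OF st(1) assms(2,4)] _ this]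
  have "pair_tree (V - {a} - {s a}) {e \<in> ?T. s a \<notin> e}" using st(2) assms(2,3) by blast
  moreover have "V - {a} - {s a} = V - {a, s a}" "{e \<in> ?T. s a \<notin> e} = away a T"
    by (auto simp: away_def)
  ultimately have "pair_tree (V - {a, s a}) (away a T)" by simp
  then show ?thesis unfolding sym_tree_def using st(2,3,4)
    by (auto simp: away_def mem_image_s)
qed

text \<open>The stars of \<open>a\<close> and \<open>s a\<close> share no edge, so the two vertices
  can be suppressed one after the other.\<close>

lemma sym_tree_suppress:
  assumes "sym_tree V T" "a \<in> V" "s a \<noteq> a" "{e \<in> T. a \<in> e} = {{a, c}, {a, d}}" "c \<noteq> d"
  shows "{c, d} \<notin> T"
    "sym_tree (V - {a, s a}) (insert {c, d} (insert {s c, s d} (away a T)))"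
proof -
  note st = sym_treeD[OF assms(1)]
  let ?T = "insert {c, d} {e \<in> T. a \<notin> e}"
  have "{a, c} \<in> T" "{a, d} \<in> T" using assms(4) by blast+
  then have ne: "c \<noteq> s a" "d \<noteq> s a" "c \<noteq> a" "d \<noteq> a"
    using st(6) pair_treeD(7)[OF st(1)] by blast+
  note p = pair_tree_suppress[OF st(1) assms(2,4,5)]
  show "{c, d} \<notin> T" by (rule p(1))
  have "s c \<noteq> a" "s d \<noteq> a" using ne(1,2) by auto
  then have "{e \<in> {{s a, s c}, {s a, s d}}. a \<notin> e} = {{s a, s c}, {s a, s d}}"
    using assms(3) by auto
  moreover have "{e \<in> T. s a \<in> e} = {{s a, s c}, {s a, s d}}"
    using sym_tree_star_image[OF assms(1), of a] assms(4) by simp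
  then have "{e \<in> {e \<in> T. a \<notin> e}. s a \<in> e} = {e \<in> {{s a, s c}, {s a, s d}}. a \<notin> e}" by blast
  ultimately have "{e \<in> {e \<in> T. a \<notin> e}. s a \<in> e} = {{s a, s c}, {s a, s d}}"
    by (rule trans[rotated])
  moreover have "{e \<in> ?T. s a \<in> e} = {e \<in> {e \<in> T. a \<notin> e}. s a \<in> e}" using ne(1,2) by blast
  ultimately have star: "{e \<in> ?T. s a \<in> e} = {{s a, s c}, {s a, s d}}" by simp
  have "s a \<in> V - {a}" using st(2) assms(2,3) by blast
  note p' = pair_tree_suppress[OF p(2) this star]
  \<comment> \<open>The second suppression takes place in a tree that already contains
    \<open>{c, d}\<close>, so its new edge differs from \<open>{c, d}\<close>. This is why the new
    edges are not fixed.\<close>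
  have new: "{s c, s d} \<notin> ?T" using p'(1) assms(5) by simp
  have "pair_tree (V - {a} - {s a}) (insert {s c, s d} {e \<in> ?T. s a \<notin> e})"
    using p'(2) assms(5) by simp
  moreover have "V - {a} - {s a} = V - {a, s a}"
    "insert {s c, s d} {e \<in> ?T. s a \<notin> e} = insert {c, d} (insert {s c, s d} (away a T))"
    using ne by (auto simp: away_def)
  ultimately have "pair_tree (V - {a, s a}) (insert {c, d} (insert {s c, s d} (away a T)))"
    by simp
  moreover have "s ` {c, d} \<noteq> {c, d}" "s ` {s c, s d} \<noteq> {s c, s d}" using new by auto
  ultimately show "sym_tree (V - {a, s a}) (insert {c, d} (insert {s c, s d} (away a T)))"
    unfolding sym_tree_def using st(2,3,4) by (auto simp: away_def mem_image_s)
qed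

section \<open>Counting degrees to find a removable vertex\<close>

lemma pair_tree_degree_sum:
  assumes "pair_tree V T"
  shows "(\<Sum>v\<in>V. card {e \<in> T. v \<in> e}) = 2 * card T"
proof (rule sum_multicount)
  show "\<forall>e\<in>T. card {v \<in> V. v \<in> e} = 2"
  proof
    fix e assume e: "e \<in> T"
    then have "{v \<in> V. v \<in> e} = e" using pair_treeD(2)[OF assms] by blast
    then show "card {v \<in> V. v \<in> e} = 2" using pair_treeD(3)[OF assms e] by simp
  qed
qed (use pair_treeD(1,6)[OF assms] in auto)

lemma pair_tree_degree_pos:
  assumes "pair_tree V T" "card V \<noteq> 1" "v \<in> V"
  shows "card {e \<in> T. v \<in> e} > 0"
proof -
  have "V \<noteq> {v}" using assms(2) by auto
  then obtain w where "w \<in> V" "w \<noteq> v" using assms(3) by blast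
  then have "\<exists>e\<in>T. v \<in> e"
    using pair_treeD(4)[OF assms(1), of w v] assms(3) link_isolated[of w v T] by blast
  then show ?thesis using pair_treeD(6)[OF assms(1)] by (auto simp: card_gt_0_iff)
qed

lemma pair_tree_star_1:
  assumes "pair_tree V T" "card {e \<in> T. a \<in> e} = 1"
  obtains b where "{e \<in> T. a \<in> e} = {{a, b}}"
proof -
  obtain e where e: "{e \<in> T. a \<in> e} = {e}" using assms(2) by (rule card_1_singletonE)
  then obtain x y where "e = {x, y}" "a \<in> e" using pair_treeD(8)[OF assms(1), of e] by blast
  then show thesis using that e by (metis insertE insert_commute singletonD)
qed

lemma pair_tree_star_2:
  assumes "pair_tree V T" "card {e \<in> T. a \<in> e} = 2"
  obtains c d where "{e \<in> T. a \<in> e} = {{a, c}, {a, d}}" "c \<noteq> d"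
proof -
  obtain e f where e: "{e \<in> T. a \<in> e} = {e, f}" "e \<noteq> f" using assms(2) by (auto simp: card_2_iff)
  have *: "\<exists>b. g = {a, b}" if "g \<in> {e, f}" for g
  proof -
    have "g \<in> T" "a \<in> g" using that e(1) by blast+
    then show ?thesis using pair_treeD(8)[OF assms(1), of g] by blast
  qed
  obtain c d where "e = {a, c}" "f = {a, d}" using *[of e] *[of f] by auto
  then show thesis using that e by blast
qed

text \<open>The degrees in both trees add up to \<open>4 * card V - 4\<close>. If every vertex moved
  by \<open>s\<close> had total degree at least 4, the sum would be at least
  \<open>4 * card V - 2\<close>, because the at most one fixed vertex still has degree at least
  2.\<close>

lemma low_degree_vertex:
  assumes "sym_tree V T1" "sym_tree V T2" "card V \<noteq> 1"
  obtains a where "a \<in> V" "s a \<noteq> a"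
    "card {e \<in> T1. a \<in> e} > 0" "card {e \<in> T2. a \<in> e} > 0"
    "card {e \<in> T1. a \<in> e} + card {e \<in> T2. a \<in> e} \<le> 3"
proof -
  note p1 = sym_treeD(1)[OF assms(1)] and p2 = sym_treeD(1)[OF assms(2)]
  let ?d = "\<lambda>v. card {e \<in> T1. v \<in> e} + card {e \<in> T2. v \<in> e}"
  let ?X = "{v \<in> V. s v = v}"
  have fin: "finite V" using pair_treeD(1)[OF p1] .
  have "\<exists>a\<in>V. s a \<noteq> a \<and> ?d a \<le> 3"
  proof (rule ccontr)
    assume *: "\<not> ?thesis"
    have "4 \<le> ?d v + (if s v = v then 2 else 0)" if "v \<in> V" for v
      using * that pair_tree_degree_pos[OF p1 assms(3) that] pair_tree_degree_pos[OF p2 assms(3) that]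
      by force
    then have "of_nat (card V) * 4 \<le> (\<Sum>v\<in>V. ?d v + (if s v = v then 2 else 0))"
      by (rule sum_bounded_below)
    also have "\<dots> = 2 * card T1 + 2 * card T2 + 2 * card ?X"
      using fin by (simp add: sum.distrib pair_tree_degree_sum[OF p1] pair_tree_degree_sum[OF p2]
          sum.If_cases Int_def)
    finally have "4 * card V \<le> 2 * card T1 + 2 * card T2 + 2 * card ?X" by simp
    moreover have "card ?X \<le> 1"
      using sym_tree_fixed_unique[OF assms(1)] fin card_le_Suc0_iff_eq[of ?X] by simp
    ultimately show False using pair_treeD(5)[OF p1] pair_treeD(5)[OF p2] by linarith
  qed
  then show thesis
    using that pair_tree_degree_pos[OF p1 assms(3)] pair_tree_degree_pos[OF p2 assms(3)] by blast
qed

end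

section \<open>Placements and their perturbation\<close>

lemma beyond:
  fixes t :: real
  assumes "t \<noteq> 0"
  shows "\<exists>z. 0 < t * (z - p) \<and> 0 < t * (z - q) \<and> 0 < t * (z - r)"
proof (cases "0 < t")
  case True
  then show ?thesis by (intro exI[of _ "max p (max q r) + 1"]) (auto intro!: mult_pos_pos)
next
  case False
  then show ?thesis using assms
    by (intro exI[of _ "min p (min q r) - 1"]) (auto intro!: mult_neg_neg)
qed

text \<open>With \<open>p\<close> halfway between \<open>b1\<close> and \<open>c1\<close> the first
  factors have opposite signs, and a \<open>q\<close> far out on the proper side settles both
  products. If \<open>b1 = c1\<close>, the coordinates are interchanged.\<close>

lemma place_two:
  fixes \<sigma> :: real
  assumes "\<sigma> \<noteq> 0" "b1 \<noteq> c1 \<or> b2 \<noteq> c2"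
  shows "\<exists>p q. 0 < \<sigma> * ((p - c1) * (q - c2)) \<and> 0 < - \<sigma> * ((p - b1) * (q - b2))"
proof -
  have *: "\<exists>p q. 0 < \<sigma> * ((p - c1) * (q - c2)) \<and> 0 < - \<sigma> * ((p - b1) * (q - b2))"
    if bc: "b1 \<noteq> c1" for b1 c1 b2 c2
  proof -
    obtain q where q: "0 < \<sigma> * (b1 - c1) * (q - c2)" "0 < \<sigma> * (b1 - c1) * (q - b2)"
      using beyond[of "\<sigma> * (b1 - c1)" c2 b2 0] assms(1) bc by auto
    show ?thesis
      by (rule exI[of _ "(b1 + c1) / 2"], rule exI[of _ q]) (use q in \<open>auto simp: field_simps\<close>)
  qed
  show ?thesis using *[of b1 c1 c2 b2] *[of b2 c2 c1 b1] assms(2) by (metis mult.commute)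
qed

text \<open>The hypothesis puts \<open>b1\<close> strictly on one side of both \<open>c1\<close> and
  \<open>d1\<close>. With \<open>p\<close> in the gap, a far \<open>q\<close> on the side determined
  by \<open>\<sigma>\<close> and that order satisfies all three conditions.\<close>

lemma place_outside:
  fixes \<sigma> :: real
  assumes "\<sigma> \<noteq> 0" "0 < (b1 - c1) * (b1 - d1)"
  shows "\<exists>p q. 0 < \<sigma> * ((p - c1) * (q - c2)) \<and> 0 < \<sigma> * ((p - d1) * (q - d2)) \<and>
    0 < - \<sigma> * ((p - b1) * (q - b2))"
proof -
  obtain p where p: "p < b1 \<and> c1 < p \<and> d1 < p \<or> b1 < p \<and> p < c1 \<and> p < d1"
  proof (cases "c1 < b1")
    case True
    then have "max c1 d1 < b1" using assms(2) by (auto simp: zero_less_mult_iff)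
    then obtain p where "max c1 d1 < p" "p < b1" using dense by blast
    then show thesis using that by auto
  next
    case False
    then have "b1 < min c1 d1" using assms(2) by (auto simp: zero_less_mult_iff)
    then obtain p where "p < min c1 d1" "b1 < p" using dense by blast
    then show thesis using that by auto
  qed
  define t where "t = (if p < b1 then \<sigma> else - \<sigma>)"
  obtain q where q: "0 < t * (q - c2)" "0 < t * (q - d2)" "0 < t * (q - b2)"
    using beyond[of t c2 d2 b2] assms(1) unfolding t_def by (metis neg_equal_0_iff_equal)
  show ?thesis
  proof (cases "p < b1")
    case True
    then have "0 < (p - c1) * (\<sigma> * (q - c2))" "0 < (p - d1) * (\<sigma> * (q - d2))"
      "0 < (b1 - p) * (\<sigma> * (q - b2))"
      using p q by (auto simp: t_def intro!: mult_pos_pos)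
    then show ?thesis by (intro exI[of _ p] exI[of _ q]) (simp add: algebra_simps)
  next
    case False
    then have "0 < (c1 - p) * (- \<sigma> * (q - c2))" "0 < (d1 - p) * (- \<sigma> * (q - d2))"
      "0 < (p - b1) * (- \<sigma> * (q - b2))"
      using p q by (auto simp only: t_def if_False intro!: mult_pos_pos)
    then show ?thesis by (intro exI[of _ p] exI[of _ q]) (simp add: algebra_simps)
  qed
qed

text \<open>For \<open>\<sigma> = 1\<close> the points \<open>c\<close> and \<open>d\<close> are
  opposite corners of a box with increasing diagonal. Either \<open>b\<close> leaves the range of
  the box in one coordinate, or it lies in the box away from these two corners.\<close>

lemma place_three:
  fixes \<sigma> :: real
  assumes "\<sigma> = 1 \<or> \<sigma> = -1" "0 < \<sigma> * ((c1 - d1) * (c2 - d2))"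
    and "b1 \<noteq> c1 \<or> b2 \<noteq> c2" "b1 \<noteq> d1 \<or> b2 \<noteq> d2"
  shows "\<exists>p q. 0 < \<sigma> * ((p - c1) * (q - c2)) \<and> 0 < \<sigma> * ((p - d1) * (q - d2)) \<and>
    0 < - \<sigma> * ((p - b1) * (q - b2))"
proof -
  have A: "\<exists>p q. 0 < (p - c1) * (q - c2) \<and> 0 < (p - d1) * (q - d2) \<and> 0 < - ((p - b1) * (q - b2))"
    if cd: "c1 < d1" "c2 < d2" and bc: "b1 \<noteq> c1 \<or> b2 \<noteq> c2" and bd: "b1 \<noteq> d1 \<or> b2 \<noteq> d2"
    for b1 b2 c1 c2 d1 d2 :: real
  proof -
    \<comment> \<open>In the last two cases \<open>b\<close> lies in the closed box, and the new
      point is put inside the box, to the upper left or to the lower right of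
      \<open>b\<close>.\<close>
    consider "0 < (b1 - c1) * (b1 - d1)" | "0 < (b2 - c2) * (b2 - d2)"
      | "c1 < b1" "b1 \<le> d1" "c2 \<le> b2" "b2 < d2" | "c1 \<le> b1" "b1 < d1" "c2 < b2" "b2 \<le> d2"
      using cd bc bd unfolding zero_less_mult_iff by (smt (verit))
    then show ?thesis
    proof cases
      case 1
      show ?thesis using place_outside[OF _ 1, of 1 c2 d2 b2] by simp
    next
      case 2
      obtain p q where "0 < (p - c2) * (q - c1)" "0 < (p - d2) * (q - d1)" "0 < - ((p - b2) * (q - b1))"
        using place_outside[OF _ 2, of 1 c1 d1 b1] by auto
      then show ?thesis by (intro exI[of _ q] exI[of _ p]) (simp add: mult.commute)
    next
      case 3
      obtain p q where "c1 < p" "p < b1" "b2 < q" "q < d2"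
        using dense[OF 3(1)] dense[OF 3(4)] by blast
      then show ?thesis using 3
        by (intro exI[of _ p] exI[of _ q]) (simp add: zero_less_mult_iff mult_less_0_iff)
    next
      case 4
      obtain p q where "b1 < p" "p < d1" "c2 < q" "q < b2"
        using dense[OF 4(2)] dense[OF 4(3)] by blast
      then show ?thesis using 4
        by (intro exI[of _ p] exI[of _ q]) (simp add: zero_less_mult_iff mult_less_0_iff)
    qed
  qed
  have B: "\<exists>p q. 0 < (p - c1) * (q - c2) \<and> 0 < (p - d1) * (q - d2) \<and> 0 < - ((p - b1) * (q - b2))"
    if cd: "0 < (c1 - d1) * (c2 - d2)" and bc: "b1 \<noteq> c1 \<or> b2 \<noteq> c2" and bd: "b1 \<noteq> d1 \<or> b2 \<noteq> d2"
    for b1 b2 c1 c2 d1 d2 :: real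
  proof -
    consider "c1 < d1" "c2 < d2" | "d1 < c1" "d2 < c2"
      using cd unfolding zero_less_mult_iff by linarith
    then show ?thesis using A[OF _ _ bc bd] A[OF _ _ bd bc] by cases blast+
  qed
  show ?thesis
    using assms(1)
  proof
    assume "\<sigma> = 1"
    then show ?thesis using B[of c1 d1 c2 d2] assms(2-4) by simp
  next
    assume \<sigma>: "\<sigma> = -1"
    \<comment> \<open>Negating the second coordinate turns this sign into the previous one.\<close>
    then have "0 < (c1 - d1) * (- c2 - - d2)" using assms(2) by (simp add: algebra_simps)
    then obtain p q where "0 < (p - c1) * (q - - c2)" "0 < (p - d1) * (q - - d2)"
      "0 < - ((p - b1) * (q - - b2))"
      using B[of c1 d1 "- c2" "- d2" b1 "- b2"] assms(3,4) by auto
    then show ?thesis using \<sigma> by (intro exI[of _ p] exI[of _ "- q"]) (simp add: algebra_simps)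
  qed
qed

section \<open>Functions with no coincidences beyond the prescribed ones\<close>

definition generic :: "'v set \<Rightarrow> 'v set set \<Rightarrow> ('v \<Rightarrow> real) \<Rightarrow> bool" where
  "generic V F u \<longleftrightarrow> (\<forall>x\<in>V. \<forall>y\<in>V. u x = u y \<longleftrightarrow> (x, y) \<in> link F)"

text \<open>Number the components of \<open>F\<close> and give each vertex the number of its
  component.\<close>

lemma ex_generic:
  assumes "finite V"
  shows "\<exists>g. generic V F g"
proof -
  let ?K = "\<lambda>x. {y. (x, y) \<in> link F}"
  have K: "?K x = ?K y \<longleftrightarrow> (x, y) \<in> link F" for x y
    using link_trans[of x y F] link_trans[OF link_sym, of x y F] link_refl[of y F] by blast
  obtain h :: "'a set \<Rightarrow> nat" where h: "inj_on h (?K ` V)"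
    using finite_imp_inj_to_nat_seg[of "?K ` V"] assms by blast
  have "h (?K x) = h (?K y) \<longleftrightarrow> (x, y) \<in> link F" if "x \<in> V" "y \<in> V" for x y
    using inj_on_eq_iff[OF h, of "?K x" "?K y"] K[of x y] that by simp
  then have "generic V F (\<lambda>x. real (h (?K x)))" by (simp add: generic_def)
  then show ?thesis by blast
qed

text \<open>Vertices linked in \<open>F\<close> keep equal values because \<open>u\<close> and
  \<open>g\<close> agree on them. For any other pair the values collide for at most one
  \<open>\<epsilon>\<close>.\<close>

lemma eventually_generic:
  assumes "finite V" "\<And>x y. {x, y} \<in> F \<Longrightarrow> u x = u y" "generic V F g"
  shows "\<forall>\<^sub>F \<epsilon> in at_right 0. generic V F (\<lambda>x. u x + \<epsilon> * g x)"
  unfolding generic_def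
proof (intro eventually_ball_finite assms(1) ballI)
  fix x y assume xy: "x \<in> V" "y \<in> V"
  show "\<forall>\<^sub>F \<epsilon> in at_right 0. u x + \<epsilon> * g x = u y + \<epsilon> * g y \<longleftrightarrow> (x, y) \<in> link F"
  proof (cases "(x, y) \<in> link F")
    case True
    then have "u x = u y" using link_const[of x y F u] assms(2) by blast
    then show ?thesis using True assms(3) xy by (simp add: generic_def)
  next
    case False
    then have "g x - g y \<noteq> 0" using assms(3) xy by (simp add: generic_def)
    then have "u x + \<epsilon> * g x \<noteq> u y + \<epsilon> * g y" if "\<epsilon> \<noteq> (u y - u x) / (g x - g y)" for \<epsilon>
      using that by (auto simp: field_simps)
    then have "\<forall>\<^sub>F \<epsilon> in at_right 0. u x + \<epsilon> * g x \<noteq> u y + \<epsilon> * g y"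
      using eventually_neq_at_within[of "(u y - u x) / (g x - g y)" 0 "{0<..}"]
      by (rule eventually_mono[rotated])
    then show ?thesis using False by simp
  qed
qed

lemma tendsto_at_right_perturb:
  fixes f :: "real \<Rightarrow> real"
  assumes "isCont f 0" "0 < f 0"
  shows "\<forall>\<^sub>F \<epsilon> in at_right 0. 0 < f \<epsilon>"
proof -
  have "(f \<longlongrightarrow> f 0) (at_right 0)"
    using assms(1) by (simp add: isCont_def filterlim_at_split)
  then show ?thesis using assms(2) order_tendstoD(1) by blast
qed

section \<open>Sign conditions and their stability\<close>

context involution
begin

text \<open>The product is unchanged when \<open>x\<close> and \<open>y\<close> are swapped and when
  \<open>s\<close> is applied to both, so the condition depends only on the orbit of the
  edge.\<close>

definition signs :: "real \<Rightarrow> 'v set set \<Rightarrow> ('v \<Rightarrow> real) \<Rightarrow> bool" where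
  "signs \<sigma> A u \<longleftrightarrow> (\<forall>x y. {x, y} \<in> A \<longrightarrow> 0 < \<sigma> * ((u x - u y) * (u (s x) - u (s y))))"

lemma signsD: "signs \<sigma> A u \<Longrightarrow> {x, y} \<in> A \<Longrightarrow> 0 < \<sigma> * ((u x - u y) * (u (s x) - u (s y)))"
  by (simp add: signs_def)

lemma eventually_signs:
  assumes "finite V" "\<And>e. e \<in> A \<Longrightarrow> e \<subseteq> V" "signs \<sigma> A u"
  shows "\<forall>\<^sub>F \<epsilon> in at_right 0. signs \<sigma> A (\<lambda>x. u x + \<epsilon> * g x)"
proof -
  let ?P = "\<lambda>\<epsilon> x y. {x, y} \<in> A \<longrightarrow>
    0 < \<sigma> * ((u x + \<epsilon> * g x - (u y + \<epsilon> * g y)) * (u (s x) + \<epsilon> * g (s x) - (u (s y) + \<epsilon> * g (s y))))"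
  have "\<forall>\<^sub>F \<epsilon> in at_right 0. \<forall>x\<in>V. \<forall>y\<in>V. ?P \<epsilon> x y"
  proof (intro eventually_ball_finite assms(1) ballI)
    fix x y
    show "\<forall>\<^sub>F \<epsilon> in at_right 0. ?P \<epsilon> x y"
    proof (cases "{x, y} \<in> A")
      case True
      have "\<forall>\<^sub>F \<epsilon> in at_right 0. 0 < \<sigma> * ((u x + \<epsilon> * g x - (u y + \<epsilon> * g y)) *
          (u (s x) + \<epsilon> * g (s x) - (u (s y) + \<epsilon> * g (s y))))"
        by (rule tendsto_at_right_perturb) (use signsD[OF assms(3) True] in \<open>auto intro!: continuous_intros\<close>)
      then show ?thesis by (rule eventually_mono) simp
    qed simp
  qed
  then show ?thesis
  proof (rule eventually_mono)
    fix \<epsilon> assume "\<forall>x\<in>V. \<forall>y\<in>V. ?P \<epsilon> x y"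
    then show "signs \<sigma> A (\<lambda>x. u x + \<epsilon> * g x)" unfolding signs_def using assms(2) by blast
  qed
qed

text \<open>The sign \<open>\<sigma>\<close> makes the roles of the two trees interchangeable.\<close>
definition realisable :: "real \<Rightarrow> 'v set \<Rightarrow> 'v set set \<Rightarrow> 'v set set \<Rightarrow> bool" where
  "realisable \<sigma> V T1 T2 \<longleftrightarrow> (\<forall>F. half F (T1 \<inter> T2) \<longrightarrow>
     (\<exists>u. generic V F u \<and> signs \<sigma> (T2 - T1) u \<and> signs (- \<sigma>) (T1 - T2) u))"

lemma realisable_swap: "realisable (- \<sigma>) V T2 T1 \<longleftrightarrow> realisable \<sigma> V T1 T2"
  by (simp add: realisable_def Int_commute conj_commute)

text \<open>Constructions may produce accidental coincidences: a small generic perturbation that is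
  constant along \<open>F\<close> removes them and preserves the strict inequalities.\<close>

lemma realisableI:
  assumes "pair_tree V T1" "pair_tree V T2"
    and "\<And>F. half F (T1 \<inter> T2) \<Longrightarrow>
      \<exists>u. (\<forall>x y. {x, y} \<in> F \<longrightarrow> u x = u y) \<and> signs \<sigma> (T2 - T1) u \<and> signs (- \<sigma>) (T1 - T2) u"
  shows "realisable \<sigma> V T1 T2"
  unfolding realisable_def
proof (intro allI impI)
  fix F assume "half F (T1 \<inter> T2)"
  then obtain u where u: "\<And>x y. {x, y} \<in> F \<Longrightarrow> u x = u y"
    "signs \<sigma> (T2 - T1) u" "signs (- \<sigma>) (T1 - T2) u"
    using assms(3) by meson
  have fin: "finite V" using pair_treeD(1)[OF assms(1)] .
  obtain g where g: "generic V F g" using ex_generic[OF fin] by blast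
  have "\<forall>\<^sub>F \<epsilon> in at_right 0. generic V F (\<lambda>x. u x + \<epsilon> * g x) \<and>
    signs \<sigma> (T2 - T1) (\<lambda>x. u x + \<epsilon> * g x) \<and> signs (- \<sigma>) (T1 - T2) (\<lambda>x. u x + \<epsilon> * g x)"
    using pair_treeD(2)[OF assms(1)] pair_treeD(2)[OF assms(2)]
    by (intro eventually_conj eventually_generic eventually_signs[OF fin] fin u g) blast+
  then show "\<exists>u. generic V F u \<and> signs \<sigma> (T2 - T1) u \<and> signs (- \<sigma>) (T1 - T2) u"
    using eventually_happens trivial_limit_at_right_real by blast
qed

section \<open>Reinserting a vertex of low degree\<close>

lemma half_away: "half F D \<Longrightarrow> half (away a F) (away a D)"
  unfolding half_def
proof (elim conjE, intro conjI)
  have *: "(`) s ` away a F = away a ((`) s ` F)"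
    by (auto simp: away_def mem_image_s intro!: imageI)
  assume F: "F \<union> (`) s ` F = D" "F \<inter> (`) s ` F = {}"
  show "away a F \<union> (`) s ` away a F = away a D" unfolding * F(1)[symmetric] by (auto simp: away_def)
  show "away a F \<inter> (`) s ` away a F = {}" using F(2) by (auto simp: away_def)
qed

lemma halfD:
  assumes "half F D"
  shows "F \<subseteq> D" "\<And>x y. {x, y} \<in> F \<Longrightarrow> {s x, s y} \<in> D"
proof -
  show "F \<subseteq> D" using assms by (auto simp: half_def)
  show "{s x, s y} \<in> D" if "{x, y} \<in> F" for x y
    using imageI[OF that, of "(`) s"] assms by (auto simp: half_def)
qed

lemma away_inter: "away a A \<inter> away a B = away a (A \<inter> B)"
  and away_diff: "away a A - away a B = away a (A - B)"
  by (auto simp: away_def)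

text \<open>The condition at an edge of \<open>s a\<close> is the one at its mirror image, so only
  the star of \<open>a\<close> has to be checked.\<close>

lemma signs_star:
  assumes "\<And>e. e \<in> A \<Longrightarrow> s ` e \<in> A" "signs \<sigma> (away a A) u"
    and "\<And>x. {a, x} \<in> A \<Longrightarrow> 0 < \<sigma> * ((u a - u x) * (u (s a) - u (s x)))"
  shows "signs \<sigma> A u"
  unfolding signs_def
proof (intro allI impI)
  fix x y assume xy: "{x, y} \<in> A"
  have star: "0 < \<sigma> * ((u x - u y) * (u (s x) - u (s y)))"
    if xy: "{x, y} \<in> A" and x: "x = a \<or> x = s a" for x y
    using x
  proof
    assume "x = a"
    then show ?thesis using assms(3) xy by blast
  next
    assume x: "x = s a"
    then have "{a, s y} \<in> A" using assms(1)[OF xy] by simp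
    then show ?thesis using assms(3)[of "s y"] x by (simp add: mult.commute)
  qed
  have "{y, x} \<in> A" using xy by (simp add: insert_commute)
  consider "x = a \<or> x = s a" | "y = a \<or> y = s a" | "{x, y} \<in> away a A"
    using xy by (auto simp: away_def)
  then show "0 < \<sigma> * ((u x - u y) * (u (s x) - u (s y)))"
  proof cases
    case 2
    then show ?thesis using star[OF \<open>{y, x} \<in> A\<close>] by (simp add: algebra_simps)
  next
    case 3
    then show ?thesis using assms(2) signsD by blast
  qed (use star[OF xy] in simp)
qed

lemma signs_away_upd:
  "signs \<sigma> (away a A) u \<Longrightarrow> signs \<sigma> (away a A) (u(a := p, s a := q))"
  unfolding signs_def
proof (intro allI impI)
  fix x y
  assume *: "\<forall>x y. {x, y} \<in> away a A \<longrightarrow> 0 < \<sigma> * ((u x - u y) * (u (s x) - u (s y)))"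
    and xy: "{x, y} \<in> away a A"
  have "x \<noteq> a" "x \<noteq> s a" "y \<noteq> a" "y \<noteq> s a" using xy by (auto simp: away_def)
  moreover from this have "s x \<noteq> a" "s x \<noteq> s a" "s y \<noteq> a" "s y \<noteq> s a" by auto
  ultimately show "0 < \<sigma> * (((u(a := p, s a := q)) x - (u(a := p, s a := q)) y) *
      ((u(a := p, s a := q)) (s x) - (u(a := p, s a := q)) (s y)))"
    using * xy by simp
qed

text \<open>Unlike the sign conditions, the equalities are not invariant under \<open>s\<close>, so
  the stars of \<open>a\<close> and \<open>s a\<close> are checked separately.\<close>

lemma const_star:
  assumes "\<And>x y. {x, y} \<in> away a F \<Longrightarrow> u x = u y"
    and "\<And>x. {a, x} \<in> F \<Longrightarrow> u a = u x" "\<And>x. {s a, x} \<in> F \<Longrightarrow> u (s a) = u x"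
    and "{x, y} \<in> F"
  shows "u x = u y"
proof -
  have "{y, x} \<in> F" using assms(4) by (simp add: insert_commute)
  moreover consider "x = a" | "x = s a" | "y = a" | "y = s a" | "{x, y} \<in> away a F"
    using assms(4) by (auto simp: away_def)
  ultimately show ?thesis using assms(1,4) assms(2)[of x] assms(2)[of y] assms(3)[of x] assms(3)[of y]
    by cases (metis insert_commute)+
qed

lemma sym_tree_nbr:
  assumes "sym_tree V T" "{a, b} \<in> T"
  shows "b \<noteq> a" "b \<noteq> s a" "s b \<noteq> a" "s b \<noteq> s a" "b \<in> V" "s b \<in> V"
proof -
  have *: "a \<noteq> b" "b \<in> V" using pair_treeD(7)[OF sym_treeD(1)[OF assms(1)] assms(2)] by auto
  show "b \<noteq> a" "b \<in> V" "s b \<noteq> s a" "s b \<in> V" using * sym_treeD(2)[OF assms(1)] by auto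
  show "b \<noteq> s a" using sym_treeD(6)[OF assms] .
  then show "s b \<noteq> a" by auto
qed

text \<open>Agreement in both coordinates would link \<open>b\<close> and \<open>c\<close> both in
  \<open>F\<close> and in its mirror image, which are disjoint edge sets of one tree. Hence distinct
  vertices receive distinct points of the plane.\<close>

lemma generic_separates:
  assumes "sym_tree V T" "half F D" "D \<subseteq> T" "generic V F u" "b \<in> V" "c \<in> V" "b \<noteq> c"
  shows "u b \<noteq> u c \<or> u (s b) \<noteq> u (s c)"
proof (rule ccontr)
  assume "\<not> ?thesis"
  then have "(b, c) \<in> link F" "(s b, s c) \<in> link F"
    using assms(4-6) sym_treeD(2)[OF assms(1)] by (auto simp: generic_def)
  then have "(b, c) \<in> link F" "(b, c) \<in> link ((`) s ` F)" by (simp_all add: link_image)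
  then show False
    using pair_tree_disjoint_links[OF sym_treeD(1)[OF assms(1)], of F "(`) s ` F" b c] assms(2,3,7)
    unfolding half_def by blast
qed

lemma realisable_add_leaf_leaf:
  assumes T: "sym_tree V T1" "sym_tree V T2" and a: "a \<in> V" "s a \<noteq> a"
    and star1: "{e \<in> T1. a \<in> e} = {{a, b}}" and star2: "{e \<in> T2. a \<in> e} = {{a, c}}"
    and \<sigma>: "\<sigma> \<noteq> 0"
    and IH: "realisable \<sigma> (V - {a, s a}) (away a T1) (away a T2)"
  shows "realisable \<sigma> V T1 T2"
proof (rule realisableI[OF sym_treeD(1)[OF T(1)] sym_treeD(1)[OF T(2)]])
  fix F assume F: "half F (T1 \<inter> T2)"
  obtain u where u: "generic (V - {a, s a}) (away a F) u" "signs \<sigma> (away a (T2 - T1)) u"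
    "signs (- \<sigma>) (away a (T1 - T2)) u"
    using IH half_away[OF F, of a] unfolding realisable_def away_inter away_diff by blast
  have ab: "{a, b} \<in> T1" "{a, c} \<in> T2" using star1 star2 by blast+
  have nb: "x = b" if "{a, x} \<in> T1" for x
  proof -
    have "{a, x} \<in> {{a, b}}" unfolding star1[symmetric] using that by simp
    then show ?thesis by (auto simp: doubleton_eq_iff)
  qed
  have nc: "x = c" if "{a, x} \<in> T2" for x
  proof -
    have "{a, x} \<in> {{a, c}}" unfolding star2[symmetric] using that by simp
    then show ?thesis by (auto simp: doubleton_eq_iff)
  qed
  note b = sym_tree_nbr[OF T(1) ab(1)] and c = sym_tree_nbr[OF T(2) ab(2)]
  have const: "u x = u y" if "{x, y} \<in> away a F" for x y
  proof -
    have "{x, y} \<in> T1" using that halfD(1)[OF F] by (auto simp: away_def)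
    then have "x \<in> V - {a, s a}" "y \<in> V - {a, s a}"
      using that pair_treeD(7)[OF sym_treeD(1)[OF T(1)], of x y] by (auto simp: away_def)
    then show ?thesis using u(1) link_edge[OF that] by (auto simp: generic_def)
  qed
  have star_F: "x = b \<and> b = c" if "{a, x} \<in> F" for x using that halfD(1)[OF F] nb nc by blast
  have star_sF: "x = s b \<and> b = c" if "{s a, x} \<in> F" for x
    using halfD(2)[OF F that] nb[of "s x"] nc[of "s x"] by auto
  \<comment> \<open>If \<open>b = c\<close>, the edge at \<open>a\<close> is a parallel pair and
    \<open>a\<close> is put on top of \<open>b\<close>; \<open>realisableI\<close> separates them
    afterwards. Otherwise the points of \<open>b\<close> and \<open>c\<close> are distinct, as
    \<open>place_two\<close> requires.\<close>
  obtain p q where pq: "b = c \<Longrightarrow> p = u b \<and> q = u (s b)"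
    "b \<noteq> c \<Longrightarrow> 0 < \<sigma> * ((p - u c) * (q - u (s c))) \<and> 0 < - \<sigma> * ((p - u b) * (q - u (s b)))"
  proof (cases "b = c")
    case False
    have "u b \<noteq> u c \<or> u (s b) \<noteq> u (s c)"
      using generic_separates[OF sym_tree_delete_leaf[OF T(1) a star1] half_away[OF F] _ u(1)]
        b c False by (auto simp: away_def)
    from place_two[OF \<sigma> this] show thesis using that False by blast
  qed (use that[of "u b" "u (s b)"] in blast)
  let ?u = "u(a := p, s a := q)"
  have u': "?u a = p" "?u (s a) = q" "?u b = u b" "?u (s b) = u (s b)" "?u c = u c" "?u (s c) = u (s c)"
    using a(2) b c by auto
  have "?u x = ?u y" if "{x, y} \<in> F" for x y
  proof (rule const_star[of a F ?u])
    show "?u x = ?u y" if "{x, y} \<in> away a F" for x y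
      using const[OF that] that by (auto simp: away_def)
    show "?u a = ?u x" if "{a, x} \<in> F" for x using star_F[OF that] pq(1) u' by simp
    show "?u (s a) = ?u x" if "{s a, x} \<in> F" for x using star_sF[OF that] pq(1) u' by simp
  qed (rule that)
  moreover have "signs \<sigma> (T2 - T1) ?u"
  proof (rule signs_star[OF _ signs_away_upd[OF u(2)]])
    show "s ` e \<in> T2 - T1" if "e \<in> T2 - T1" for e
      using that sym_treeD(3)[OF T(2), of e] sym_treeD(3)[OF T(1), of "s ` e"] by auto
    show "0 < \<sigma> * ((?u a - ?u x) * (?u (s a) - ?u (s x)))" if "{a, x} \<in> T2 - T1" for x
    proof -
      have "x = c" "b \<noteq> c" using that nc ab(1) by auto
      then show ?thesis using pq(2) u' by simp
    qed
  qed
  moreover have "signs (- \<sigma>) (T1 - T2) ?u"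
  proof (rule signs_star[OF _ signs_away_upd[OF u(3)]])
    show "s ` e \<in> T1 - T2" if "e \<in> T1 - T2" for e
      using that sym_treeD(3)[OF T(1), of e] sym_treeD(3)[OF T(2), of "s ` e"] by auto
    show "0 < - \<sigma> * ((?u a - ?u x) * (?u (s a) - ?u (s x)))" if "{a, x} \<in> T1 - T2" for x
    proof -
      have "x = b" "b \<noteq> c" using that nb ab(2) by auto
      then show ?thesis using pq(2) u' by simp
    qed
  qed
  ultimately show "\<exists>u. (\<forall>x y. {x, y} \<in> F \<longrightarrow> u x = u y) \<and> signs \<sigma> (T2 - T1) u \<and>
      signs (- \<sigma>) (T1 - T2) u" by (intro exI[of _ ?u]) blast
qed

text \<open>If suppressing a vertex doubles the edge \<open>cd\<close>, that edge is first drawn degenerate and then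
  tilted back by a perturbation of \<open>u\<close>. The vertex \<open>b\<close> stays outside the strip between \<open>c\<close> and
  \<open>d\<close> because it is not aligned with them before the perturbation.\<close>
lemma tilt_double_edge:
  assumes T: "sym_tree W T1" "sym_tree W (insert {c, d} (insert {s c, s d} T2))"
    and cd: "{c, d} \<in> T1" "{c, d} \<notin> T2" "{s c, s d} \<notin> T2"
    and \<sigma>: "\<sigma> \<noteq> 0"
    and real: "realisable \<sigma> W T1 (insert {c, d} (insert {s c, s d} T2))"
    and F: "half F (T1 \<inter> T2)"
    and b: "b \<in> W" "b \<noteq> c \<and> b \<noteq> d \<Longrightarrow> (b, c) \<notin> link F \<and> (b, d) \<notin> link F"
  shows "\<exists>u. generic W F u \<and> signs \<sigma> (T2 - T1) u \<and> signs (- \<sigma>) (T1 - T2) u \<and>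
    (b \<noteq> c \<and> b \<noteq> d \<longrightarrow> 0 < (u b - u c) * (u b - u d))"
proof -
  let ?T2 = "insert {c, d} (insert {s c, s d} T2)" and ?F = "insert {c, d} F"
  note p1 = sym_treeD(1)[OF T(1)]
  have scd: "{s c, s d} \<in> T1" "{s c, s d} \<noteq> {c, d}"
    using sym_treeD(5)[OF T(1) cd(1)] sym_treeD(4)[OF T(1) cd(1)] by auto
  have W: "c \<in> W" "d \<in> W" "c \<noteq> d" using pair_treeD(7)[OF p1 cd(1)] by auto
  have sW: "s c \<in> W" "s d \<in> W" using sym_treeD(2)[OF T(1)] W by auto
  have FT: "F \<subseteq> T1 - {{c, d}}" "(`) s ` F \<subseteq> T1 \<inter> T2" using F cd(2) by (auto simp: half_def)
  \<comment> \<open>Of the new orbit of parallel pairs \<open>{c, d}\<close> is the chosen one,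
    which forces \<open>u c = u d\<close> in the degenerate drawing.\<close>
  have "half ?F (T1 \<inter> ?T2)"
  proof -
    have "{s c, s d} \<notin> F" using FT cd(3) F by (auto simp: half_def)
    moreover have "{c, d} \<notin> (`) s ` F" using FT(2) cd(2) by blast
    moreover have "(`) s ` ?F = insert {s c, s d} ((`) s ` F)" by simp
    moreover have "T1 \<inter> ?T2 = insert {c, d} (insert {s c, s d} (T1 \<inter> T2))" using cd(1) scd(1) by blast
    ultimately show ?thesis using F scd(2) unfolding half_def by auto
  qed
  then obtain u where u: "generic W ?F u" "signs \<sigma> (?T2 - T1) u" "signs (- \<sigma>) (T1 - ?T2) u"
    using real unfolding realisable_def by blast
  have "u c = u d" using u(1) W link_edge[of c d ?F] by (simp add: generic_def)
  then have usc: "u (s c) \<noteq> u (s d)"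
    using generic_separates[OF T(1) \<open>half ?F (T1 \<inter> ?T2)\<close> _ u(1)] W by blast
  have ub: "0 < (u b - u c) * (u b - u d)" if "b \<noteq> c \<and> b \<noteq> d"
  proof -
    have "(b, c) \<notin> link ?F" using b(2)[OF that] unfolding link_insert by blast
    then have "u b \<noteq> u c" using u(1) b(1) W by (simp add: generic_def)
    then show ?thesis using \<open>u c = u d\<close> by (metis not_real_square_gt_zero right_minus_eq)
  qed
  have "(c, d) \<notin> link F" using pair_tree_bridge[OF p1 cd(1)] link_mono[OF _ FT(1)] by blast
  have fin: "finite W" using pair_treeD(1)[OF p1] .
  \<comment> \<open>The perturbation is generic for \<open>F\<close> rather than \<open>?F\<close>:
    it respects the equalities of \<open>F\<close> but separates \<open>c\<close> from
    \<open>d\<close>.\<close>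
  obtain h where h: "generic W F h" using ex_generic[OF fin] by blast
  \<comment> \<open>Only the sign of \<open>t\<close> matters. This choice makes the tilt of
    \<open>{c, d}\<close> a positive multiple of the square of \<open>t\<close>, in the direction
    required of an edge of \<open>T1\<close> only.\<close>
  define t where "t = - \<sigma> * (h c - h d) * (u (s c) - u (s d))"
  have "h c \<noteq> h d" using h W \<open>(c, d) \<notin> link F\<close> by (simp add: generic_def)
  then have "t \<noteq> 0" using \<sigma> usc by (simp add: t_def)
  define g where "g x = t * h x" for x
  have g: "generic W F g" using h \<open>t \<noteq> 0\<close> by (simp add: generic_def g_def)
  have cst: "u x = u y" if "{x, y} \<in> F" for x y
  proof -
    have "{x, y} \<in> T1" using that FT(1) by blast
    then have "x \<in> W" "y \<in> W" using pair_treeD(7)[OF p1] by blast+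
    then show ?thesis using u(1) link_edge[of x y ?F] that by (simp add: generic_def)
  qed
  let ?u = "\<lambda>\<epsilon> x. u x + \<epsilon> * g x"
  have ev1: "\<forall>\<^sub>F \<epsilon> in at_right 0. generic W F (?u \<epsilon>)"
    by (rule eventually_generic[OF fin cst g])
  have ev2: "\<forall>\<^sub>F \<epsilon> in at_right 0. signs \<sigma> (?T2 - T1) (?u \<epsilon>)"
    by (rule eventually_signs[OF fin _ u(2)]) (use pair_treeD(2)[OF sym_treeD(1)[OF T(2)]] in blast)
  have ev3: "\<forall>\<^sub>F \<epsilon> in at_right 0. signs (- \<sigma>) (T1 - ?T2) (?u \<epsilon>)"
    by (rule eventually_signs[OF fin _ u(3)]) (use pair_treeD(2)[OF p1] in blast)
  have ev4: "\<forall>\<^sub>F \<epsilon> in at_right 0. b \<noteq> c \<and> b \<noteq> d \<longrightarrow> 0 < (?u \<epsilon> b - ?u \<epsilon> c) * (?u \<epsilon> b - ?u \<epsilon> d)"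
  proof (cases "b \<noteq> c \<and> b \<noteq> d")
    case True
    have "\<forall>\<^sub>F \<epsilon> in at_right 0. 0 < (?u \<epsilon> b - ?u \<epsilon> c) * (?u \<epsilon> b - ?u \<epsilon> d)"
      by (rule tendsto_at_right_perturb) (use ub[OF True] in \<open>auto intro!: continuous_intros\<close>)
    then show ?thesis by (rule eventually_mono) simp
  qed auto
  have "0 < t * (- \<sigma> * (h c - h d) * (u (s c) - u (s d)))"
    using \<open>t \<noteq> 0\<close> unfolding t_def[symmetric] by (metis not_real_square_gt_zero)
  then have "\<forall>\<^sub>F \<epsilon> in at_right 0. 0 < t * (- \<sigma> * (h c - h d) * (?u \<epsilon> (s c) - ?u \<epsilon> (s d)))"
    by (intro tendsto_at_right_perturb) (auto intro!: continuous_intros)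
  then have ev5: "\<forall>\<^sub>F \<epsilon> in at_right 0. 0 < - \<sigma> * ((?u \<epsilon> c - ?u \<epsilon> d) * (?u \<epsilon> (s c) - ?u \<epsilon> (s d)))"
    using eventually_at_right_less[of 0]
  proof eventually_elim
    case (elim \<epsilon>)
    \<comment> \<open>Since \<open>u c = u d\<close>, the first difference consists of the
      perturbation alone.\<close>
    have eq: "- \<sigma> * ((?u \<epsilon> c - ?u \<epsilon> d) * (?u \<epsilon> (s c) - ?u \<epsilon> (s d))) =
        \<epsilon> * (t * (- \<sigma> * (h c - h d) * (?u \<epsilon> (s c) - ?u \<epsilon> (s d))))"
      using \<open>u c = u d\<close> by (simp add: g_def algebra_simps)
    show ?case unfolding eq using elim by (rule mult_pos_pos[rotated])
  qed
  note ev = eventually_conj[OF ev1 eventually_conj[OF ev2 eventually_conj[OF ev3 eventually_conj[OF ev4 ev5]]]]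
  obtain \<epsilon> where \<epsilon>: "generic W F (?u \<epsilon>)" "signs \<sigma> (?T2 - T1) (?u \<epsilon>)" "signs (- \<sigma>) (T1 - ?T2) (?u \<epsilon>)"
    "b \<noteq> c \<and> b \<noteq> d \<longrightarrow> 0 < (?u \<epsilon> b - ?u \<epsilon> c) * (?u \<epsilon> b - ?u \<epsilon> d)"
    "0 < - \<sigma> * ((?u \<epsilon> c - ?u \<epsilon> d) * (?u \<epsilon> (s c) - ?u \<epsilon> (s d)))"
    using eventually_happens[OF ev] trivial_limit_at_right_real by (elim disjE exE conjE) blast+
  have "?T2 - T1 = T2 - T1" using cd(1) scd(1) by blast
  moreover have "signs (- \<sigma>) (T1 - T2) (?u \<epsilon>)"
    unfolding signs_def
  proof (intro allI impI)
    fix x y assume xy: "{x, y} \<in> T1 - T2"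
    show "0 < - \<sigma> * ((?u \<epsilon> x - ?u \<epsilon> y) * (?u \<epsilon> (s x) - ?u \<epsilon> (s y)))"
    proof (cases "{x, y} = {c, d} \<or> {x, y} = {s c, s d}")
      case True
      then have "x = c \<and> y = d \<or> x = d \<and> y = c \<or> x = s c \<and> y = s d \<or> x = s d \<and> y = s c"
        by (auto simp: doubleton_eq_iff)
      then show ?thesis
      proof (elim disjE conjE)
        assume "x = d" "y = c"
        then show ?thesis using \<epsilon>(5) by (simp add: algebra_simps)
      next
        assume "x = s c" "y = s d"
        then show ?thesis using \<epsilon>(5) by (simp add: mult.commute)
      next
        assume "x = s d" "y = s c"
        then show ?thesis using \<epsilon>(5) by (simp add: algebra_simps)
      qed (use \<epsilon>(5) in simp)
    next
      case False
      then show ?thesis using xy \<epsilon>(3) by (intro signsD) auto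
    qed
  qed
  ultimately show ?thesis using \<epsilon> by (intro exI[of _ "?u \<epsilon>"]) simp
qed

end

text \<open>For a vertex \<open>a\<close> that has a parallel pair to \<open>b\<close> and a further
  neighbour \<open>e\<close>. At most one coordinate of \<open>a\<close> is forced to agree with
  \<open>b\<close>; one coordinate is aligned with \<open>b\<close> and the other moves beyond that
  of \<open>e\<close>.\<close>

lemma place_degenerate:
  fixes \<sigma> :: real
  assumes "\<sigma> \<noteq> 0" "b1 \<noteq> e1" "b2 \<noteq> e2" "\<not> (P \<and> Q)"
  shows "\<exists>p q. 0 < \<sigma> * ((p - e1) * (q - e2)) \<and> (P \<longrightarrow> p = b1) \<and> (Q \<longrightarrow> q = b2)"
proof (cases Q)
  case True
  obtain p where "0 < \<sigma> * (b2 - e2) * (p - e1)"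
    using beyond[of "\<sigma> * (b2 - e2)" e1 e1 e1] assms(1,3) by auto
  then show ?thesis using True assms(4) by (intro exI[of _ p] exI[of _ b2]) (simp add: mult_ac)
next
  case False
  obtain q where "0 < \<sigma> * (b1 - e1) * (q - e2)"
    using beyond[of "\<sigma> * (b1 - e1)" e2 e2 e2] assms(1,2) by auto
  then show ?thesis using False by (intro exI[of _ b1] exI[of _ q]) (simp add: mult_ac)
qed

context involution
begin

text \<open>If \<open>{c, d}\<close> is not in \<open>T1\<close>, the drawing gives it sign
  \<open>\<sigma>\<close>, and \<open>place_three\<close> applies. Otherwise the doubled edge is
  tilted and \<open>place_outside\<close> applies in a coordinate where \<open>b\<close> was not
  aligned with it. The inequalities between \<open>c\<close> and \<open>d\<close> serve the case
  that \<open>b\<close> is one of them.\<close>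

lemma ex_drawing_suppressed:
  assumes T: "sym_tree W T1" "sym_tree W (insert {c, d} (insert {s c, s d} T2))"
    and cd: "{c, d} \<notin> T2" "{s c, s d} \<notin> T2" and W: "b \<in> W" "c \<in> W" "d \<in> W"
    and \<sigma>: "\<sigma> = 1 \<or> \<sigma> = -1"
    and real: "realisable \<sigma> W T1 (insert {c, d} (insert {s c, s d} T2))"
    and F: "half F (T1 \<inter> T2)"
  shows "\<exists>u. generic W F u \<and> signs \<sigma> (T2 - T1) u \<and> signs (- \<sigma>) (T1 - T2) u \<and>
    u c \<noteq> u d \<and> u (s c) \<noteq> u (s d) \<and>
    (b \<noteq> c \<and> b \<noteq> d \<longrightarrow> (\<exists>p q. 0 < \<sigma> * ((p - u c) * (q - u (s c))) \<and>
      0 < \<sigma> * ((p - u d) * (q - u (s d))) \<and> 0 < - \<sigma> * ((p - u b) * (q - u (s b)))))"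
proof (cases "{c, d} \<in> T1")
  case False
  let ?T2 = "insert {c, d} (insert {s c, s d} T2)"
  have "{s c, s d} \<notin> T1" using False sym_treeD(5)[OF T(1), of "s c" "s d"] by auto
  then have eq: "T1 \<inter> ?T2 = T1 \<inter> T2" "T1 - ?T2 = T1 - T2" using False by blast+
  obtain u where u: "generic W F u" "signs \<sigma> (?T2 - T1) u" "signs (- \<sigma>) (T1 - T2) u"
    using real F unfolding realisable_def eq by blast
  have cd': "0 < \<sigma> * ((u c - u d) * (u (s c) - u (s d)))"
    using signsD[OF u(2), of c d] False by simp
  have "\<exists>p q. 0 < \<sigma> * ((p - u c) * (q - u (s c))) \<and>
      0 < \<sigma> * ((p - u d) * (q - u (s d))) \<and> 0 < - \<sigma> * ((p - u b) * (q - u (s b)))" if "b \<noteq> c" "b \<noteq> d"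
    using generic_separates[OF T(1) F _ u(1) W(1,2)] generic_separates[OF T(1) F _ u(1) W(1,3)] that
    by (intro place_three[OF \<sigma> cd']) auto
  moreover have "signs \<sigma> (T2 - T1) u" using u(2) by (auto simp: signs_def)
  moreover have "u c \<noteq> u d" "u (s c) \<noteq> u (s d)" using cd' by auto
  ultimately show ?thesis using u(1,3) by blast
next
  case True
  have scd: "{s c, s d} \<in> T1" using sym_treeD(5)[OF T(1) True] .
  have \<sigma>0: "\<sigma> \<noteq> 0" using \<sigma> by auto
  have ne: "u c \<noteq> u d \<and> u (s c) \<noteq> u (s d)" if "signs (- \<sigma>) (T1 - T2) u" for u
    using signsD[OF that, of c d] True cd(1) by auto
  show ?thesis
  proof (cases "b \<noteq> c \<and> b \<noteq> d \<longrightarrow> (b, c) \<notin> link F \<and> (b, d) \<notin> link F")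
    case unlinked: True
    obtain u where u: "generic W F u" "signs \<sigma> (T2 - T1) u" "signs (- \<sigma>) (T1 - T2) u"
      "b \<noteq> c \<and> b \<noteq> d \<longrightarrow> 0 < (u b - u c) * (u b - u d)"
      using tilt_double_edge[OF T True cd \<sigma>0 real F W(1)] unlinked by blast
    show ?thesis using u ne[OF u(3)] place_outside[OF \<sigma>0] by (intro exI[of _ u]) blast
  next
    case False
    note p1 = sym_treeD(1)[OF T(1)]
    have "F \<subseteq> T1 \<inter> T2" "(`) s ` F \<subseteq> T1 \<inter> T2" "F \<inter> (`) s ` F = {}"
      using F by (auto simp: half_def)
    then have FT: "F \<subseteq> T1 - {{c, d}}" "(`) s ` F \<subseteq> T1 - {{c, d}}" "F \<inter> (`) s ` F = {}"
      using cd(1) by blast+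
    have bridge: "\<not> ((x, b) \<in> link F \<and> (b, y) \<in> link ((`) s ` F))"
      if "{x, y} = {c, d}" for x y
    proof
      assume "(x, b) \<in> link F \<and> (b, y) \<in> link ((`) s ` F)"
      then have "(x, y) \<in> link (T1 - {{c, d}})"
        using link_trans[OF link_mono[OF _ FT(1)] link_mono[OF _ FT(2)]] by blast
      then show False using pair_tree_bridge[OF p1, of x y] True that by simp
    qed
    \<comment> \<open>Links to one and the same end would close a cycle in \<open>T1\<close>, and
      links to different ends would bypass the edge \<open>{c, d}\<close>. So alignment in one
      coordinate excludes alignment in the other.\<close>
    have "\<not> ((b, x) \<in> link F \<and> (b, y) \<in> link ((`) s ` F))" if "x \<in> {c, d}" "y \<in> {c, d}" for x y
    proof (cases "x = y")
      case True
      then show ?thesis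
        using pair_tree_disjoint_links[OF p1 _ _ FT(3), of b x] FT(1,2) that False by blast
    next
      case False
      then show ?thesis using bridge[of x y] that link_sym[of b x F] by auto
    qed
    then have unlinked: "(s b, s c) \<notin> link F \<and> (s b, s d) \<notin> link F"
      using False link_image[of s b c F] link_image[of s b d F] by auto
    \<comment> \<open>The tilting lemma is now used for the mirror images of \<open>b\<close>,
      \<open>c\<close>, \<open>d\<close>. The augmented tree and \<open>F\<close> stay the same, and
      the second coordinate takes over.\<close>
    have sT: "insert {s c, s d} (insert {s (s c), s (s d)} T2) = insert {c, d} (insert {s c, s d} T2)"
      by (simp add: insert_commute)
    obtain u where u: "generic W F u" "signs \<sigma> (T2 - T1) u" "signs (- \<sigma>) (T1 - T2) u"
      "s b \<noteq> s c \<and> s b \<noteq> s d \<longrightarrow> 0 < (u (s b) - u (s c)) * (u (s b) - u (s d))"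
      using tilt_double_edge[of W T1 "s c" "s d" T2 \<sigma> F "s b", unfolded sT, OF T scd cd(2) _ \<sigma>0 real F]
        sym_treeD(2)[OF T(1) W(1)] unlinked cd(1) by auto
    then have "0 < (u (s b) - u (s c)) * (u (s b) - u (s d))" using False by simp
    from place_outside[OF \<sigma>0 this, of "u c" "u d" "u b"] obtain p q where
      "0 < \<sigma> * ((q - u (s c)) * (p - u c))" "0 < \<sigma> * ((q - u (s d)) * (p - u d))"
      "0 < - \<sigma> * ((q - u (s b)) * (p - u b))" by blast
    then show ?thesis using u(1-3) ne[OF u(3)]
      by (intro exI[of _ u] conjI impI exI[of _ p] exI[of _ q]) (simp_all add: mult.commute)
  qed
qed

text \<open>The smaller drawing already places \<open>c\<close> and \<open>d\<close> so that
  \<open>a\<close> fits between its constraints. If \<open>b\<close> is \<open>c\<close> or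
  \<open>d\<close>, the pair \<open>ab\<close> is parallel and only an alignment replaces its sign
  condition.\<close>

lemma realisable_add_leaf_branch:
  assumes T: "sym_tree V T1" "sym_tree V T2" and a: "a \<in> V" "s a \<noteq> a"
    and star1: "{e \<in> T1. a \<in> e} = {{a, b}}"
    and star2: "{e \<in> T2. a \<in> e} = {{a, c}, {a, d}}" "c \<noteq> d"
    and \<sigma>: "\<sigma> = 1 \<or> \<sigma> = -1"
    and IH: "realisable \<sigma> (V - {a, s a}) (away a T1) (insert {c, d} (insert {s c, s d} (away a T2)))"
  shows "realisable \<sigma> V T1 T2"
proof (rule realisableI[OF sym_treeD(1)[OF T(1)] sym_treeD(1)[OF T(2)]])
  fix F assume F: "half F (T1 \<inter> T2)"
  have edges: "{a, b} \<in> T1" "{a, c} \<in> T2" "{a, d} \<in> T2" using star1 star2 by blast+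
  have nb: "x = b" if "{a, x} \<in> T1" for x
  proof -
    have "{a, x} \<in> {{a, b}}" unfolding star1[symmetric] using that by simp
    then show ?thesis by (auto simp: doubleton_eq_iff)
  qed
  have nc: "x = c \<or> x = d" if "{a, x} \<in> T2" for x
  proof -
    have "{a, x} \<in> {{a, c}, {a, d}}" unfolding star2[symmetric] using that by simp
    then show ?thesis by (auto simp: doubleton_eq_iff)
  qed
  note b = sym_tree_nbr[OF T(1) edges(1)] and c = sym_tree_nbr[OF T(2) edges(2)]
    and d = sym_tree_nbr[OF T(2) edges(3)]
  note sup = sym_tree_suppress[OF T(2) a star2]
  have "{c, d} \<notin> away a T2" "{s c, s d} \<notin> away a T2"
    using sup(1) sym_treeD(5)[OF T(2), of "s c" "s d"] by (auto simp: away_def)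
  from ex_drawing_suppressed[OF sym_tree_delete_leaf[OF T(1) a star1] sup(2) this _ _ _ \<sigma> IH
      half_away[OF F, of a, folded away_inter], of b, unfolded away_diff]
  obtain u where u: "generic (V - {a, s a}) (away a F) u" "signs \<sigma> (away a (T2 - T1)) u"
      "signs (- \<sigma>) (away a (T1 - T2)) u" "u c \<noteq> u d" "u (s c) \<noteq> u (s d)"
    and place: "b \<noteq> c \<and> b \<noteq> d \<longrightarrow> (\<exists>p q. 0 < \<sigma> * ((p - u c) * (q - u (s c))) \<and>
      0 < \<sigma> * ((p - u d) * (q - u (s d))) \<and> 0 < - \<sigma> * ((p - u b) * (q - u (s b))))"
    using b c d by blast
  have const: "u x = u y" if "{x, y} \<in> away a F" for x y
  proof -
    have "{x, y} \<in> T1" using that halfD(1)[OF F] by (auto simp: away_def)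
    then have "x \<in> V - {a, s a}" "y \<in> V - {a, s a}"
      using that pair_treeD(7)[OF sym_treeD(1)[OF T(1)], of x y] by (auto simp: away_def)
    then show ?thesis using u(1) link_edge[OF that] by (auto simp: generic_def)
  qed
  have star_F: "x = b \<and> (b = c \<or> b = d)" if "{a, x} \<in> F" for x
    using that halfD(1)[OF F] nb nc by blast
  have star_sF: "x = s b \<and> (b = c \<or> b = d)" if "{s a, x} \<in> F" for x
    using halfD(2)[OF F that] nb[of "s x"] nc[of "s x"] by auto
  \<comment> \<open>\<open>F\<close> contains at most one of the two mirror edges, so at most one
    coordinate of \<open>a\<close> is prescribed.\<close>
  have excl: "\<not> ({a, b} \<in> F \<and> {s a, s b} \<in> F)"
  proof
    assume *: "{a, b} \<in> F \<and> {s a, s b} \<in> F"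
    then have "{s a, s b} \<in> (`) s ` F" using imageI[of "{a, b}" F "(`) s"] by simp
    then show False using * F unfolding half_def by blast
  qed
  have \<sigma>0: "\<sigma> \<noteq> 0" using \<sigma> by auto
  have "\<exists>p q. (b \<noteq> c \<longrightarrow> 0 < \<sigma> * ((p - u c) * (q - u (s c)))) \<and>
    (b \<noteq> d \<longrightarrow> 0 < \<sigma> * ((p - u d) * (q - u (s d)))) \<and>
    (b \<noteq> c \<and> b \<noteq> d \<longrightarrow> 0 < - \<sigma> * ((p - u b) * (q - u (s b)))) \<and>
    ({a, b} \<in> F \<longrightarrow> p = u b) \<and> ({s a, s b} \<in> F \<longrightarrow> q = u (s b))"
  proof -
    consider "b = c" | "b = d" | "b \<noteq> c" "b \<noteq> d" by blast
    then show ?thesis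
    proof cases
      case 1
      then show ?thesis using place_degenerate[OF \<sigma>0 u(4,5) excl] star2(2) by simp
    next
      case 2
      then show ?thesis
        using place_degenerate[OF \<sigma>0 u(4)[symmetric] u(5)[symmetric] excl] star2(2) by simp
    next
      case 3
      then show ?thesis using place star_F star_sF by blast
    qed
  qed
  then obtain p q where pq: "b \<noteq> c \<Longrightarrow> 0 < \<sigma> * ((p - u c) * (q - u (s c)))"
    "b \<noteq> d \<Longrightarrow> 0 < \<sigma> * ((p - u d) * (q - u (s d)))"
    "b \<noteq> c \<Longrightarrow> b \<noteq> d \<Longrightarrow> 0 < - \<sigma> * ((p - u b) * (q - u (s b)))"
    "{a, b} \<in> F \<Longrightarrow> p = u b" "{s a, s b} \<in> F \<Longrightarrow> q = u (s b)"
    by blast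
  let ?u = "u(a := p, s a := q)"
  have u': "?u a = p" "?u (s a) = q" "?u b = u b" "?u (s b) = u (s b)" "?u c = u c" "?u (s c) = u (s c)"
    "?u d = u d" "?u (s d) = u (s d)"
    using a(2) b c d by auto
  have "?u x = ?u y" if "{x, y} \<in> F" for x y
  proof (rule const_star[of a F ?u])
    show "?u x = ?u y" if "{x, y} \<in> away a F" for x y
      using const[OF that] that by (auto simp: away_def)
    show "?u a = ?u x" if ax: "{a, x} \<in> F" for x
    proof -
      have x: "x = b" using star_F[OF ax] by simp
      then have "p = u b" using pq(4) ax by simp
      then show ?thesis unfolding x u'(1,3) .
    qed
    show "?u (s a) = ?u x" if ax: "{s a, x} \<in> F" for x
    proof -
      have x: "x = s b" using star_sF[OF ax] by simp
      then have "q = u (s b)" using pq(5) ax by simp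
      then show ?thesis unfolding x u'(2,4) .
    qed
  qed (rule that)
  moreover have "signs \<sigma> (T2 - T1) ?u"
  proof (rule signs_star[OF _ signs_away_upd[OF u(2)]])
    show "s ` e \<in> T2 - T1" if "e \<in> T2 - T1" for e
      using that sym_treeD(3)[OF T(2), of e] sym_treeD(3)[OF T(1), of "s ` e"] by auto
    show "0 < \<sigma> * ((?u a - ?u x) * (?u (s a) - ?u (s x)))" if "{a, x} \<in> T2 - T1" for x
    proof -
      have "x = c \<and> b \<noteq> c \<or> x = d \<and> b \<noteq> d" using that nc[of x] edges(1) by auto
      then show ?thesis using pq(1,2) u' by auto
    qed
  qed
  moreover have "signs (- \<sigma>) (T1 - T2) ?u"
  proof (rule signs_star[OF _ signs_away_upd[OF u(3)]])
    show "s ` e \<in> T1 - T2" if "e \<in> T1 - T2" for e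
      using that sym_treeD(3)[OF T(1), of e] sym_treeD(3)[OF T(2), of "s ` e"] by auto
    show "0 < - \<sigma> * ((?u a - ?u x) * (?u (s a) - ?u (s x)))" if "{a, x} \<in> T1 - T2" for x
    proof -
      have "x = b" "b \<noteq> c" "b \<noteq> d" using that nb edges(2,3) by auto
      then show ?thesis using pq(3) u' by simp
    qed
  qed
  ultimately show "\<exists>u. (\<forall>x y. {x, y} \<in> F \<longrightarrow> u x = u y) \<and> signs \<sigma> (T2 - T1) u \<and>
      signs (- \<sigma>) (T1 - T2) u" by (intro exI[of _ ?u]) blast
qed

text \<open>Induction on the number of vertices. The sign varies because exchanging the trees
  negates it, which reduces degrees (2,1) to (1,2).\<close>

lemma sym_trees_realisable:
  assumes "sym_tree V T1" "sym_tree V T2" "\<sigma> = 1 \<or> \<sigma> = -1"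
  shows "realisable \<sigma> V T1 T2"
  using assms
proof (induction "card V" arbitrary: V T1 T2 \<sigma> rule: less_induct)
  case less
  note T = less.prems(1,2) and \<sigma> = less.prems(3)
  note p1 = sym_treeD(1)[OF T(1)] and p2 = sym_treeD(1)[OF T(2)]
  show ?case
  proof (cases "card V = 1")
    case True
    then have "T1 = {}" "T2 = {}" using pair_treeD(5,6)[OF p1] pair_treeD(5,6)[OF p2] by auto
    then show ?thesis by (intro realisableI p1 p2) (auto simp: half_def signs_def)
  next
    case False
    obtain a where a: "a \<in> V" "s a \<noteq> a"
      and deg: "card {e \<in> T1. a \<in> e} > 0" "card {e \<in> T2. a \<in> e} > 0"
        "card {e \<in> T1. a \<in> e} + card {e \<in> T2. a \<in> e} \<le> 3"
      using low_degree_vertex[OF T False] .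
    have smaller: "card (V - {a, s a}) < card V"
      using a pair_treeD(1)[OF p1] by (intro psubset_card_mono) auto
    note IH = less.hyps[OF smaller]
    have step: "realisable \<rho> V S1 S2"
      if S: "sym_tree V S1" "sym_tree V S2" "card {e \<in> S1. a \<in> e} = 1" "card {e \<in> S2. a \<in> e} = 2"
        and \<rho>: "\<rho> = 1 \<or> \<rho> = -1" for \<rho> S1 S2
    proof -
      obtain b where b: "{e \<in> S1. a \<in> e} = {{a, b}}" using pair_tree_star_1[OF sym_treeD(1)[OF S(1)] S(3)] .
      obtain c d where cd: "{e \<in> S2. a \<in> e} = {{a, c}, {a, d}}" "c \<noteq> d"
        using pair_tree_star_2[OF sym_treeD(1)[OF S(2)] S(4)] .
      show ?thesis
        by (rule realisable_add_leaf_branch[OF S(1,2) a b cd \<rho> IH[OF sym_tree_delete_leaf[OF S(1) a b]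
              sym_tree_suppress(2)[OF S(2) a cd] \<rho>]])
    qed
    consider "card {e \<in> T1. a \<in> e} = 1" "card {e \<in> T2. a \<in> e} = 1"
      | "card {e \<in> T1. a \<in> e} = 1" "card {e \<in> T2. a \<in> e} = 2"
      | "card {e \<in> T1. a \<in> e} = 2" "card {e \<in> T2. a \<in> e} = 1"
      using deg by linarith
    then show ?thesis
    proof cases
      case 1
      obtain b where b: "{e \<in> T1. a \<in> e} = {{a, b}}" using pair_tree_star_1[OF p1 1(1)] .
      obtain c where c: "{e \<in> T2. a \<in> e} = {{a, c}}" using pair_tree_star_1[OF p2 1(2)] .
      have "\<sigma> \<noteq> 0" using \<sigma> by auto
      then show ?thesis
        by (rule realisable_add_leaf_leaf[OF T a b c _ IH[OF sym_tree_delete_leaf[OF T(1) a b]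
              sym_tree_delete_leaf[OF T(2) a c] \<sigma>]])
    next
      case 2
      show ?thesis by (rule step[OF T 2 \<sigma>])
    next
      case 3
      have "realisable (- \<sigma>) V T2 T1" using \<sigma> by (intro step T 3) auto
      then show ?thesis by (simp only: realisable_swap)
    qed
  qed
qed

end

section \<open>Realisations in the plane\<close>

lemma connected_mg_iff_link: "connected_mg V T ends \<longleftrightarrow> (\<forall>x\<in>V. \<forall>y\<in>V. (x, y) \<in> link (ends ` T))"
proof -
  have "adj_rel T ends = adj_rel (ends ` T) (\<lambda>e. e)" by (auto simp: adj_rel_def)
  then show ?thesis by (simp add: connected_mg_def link_def)
qed

text \<open>Passing to end sets preserves connectedness, so it cannot lose an edge of a
  tree.\<close>

lemma spanning_tree_pairs:
  assumes "multigraph V E ends" "spanning_tree V E ends T"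
  shows "inj_on ends T" "pair_tree V (ends ` T)"
proof -
  have fin: "finite V" "finite T" and E: "\<And>e. e \<in> T \<Longrightarrow> ends e \<subseteq> V \<and> card (ends e) = 2"
    and conn: "\<And>x y. x \<in> V \<Longrightarrow> y \<in> V \<Longrightarrow> (x, y) \<in> link (ends ` T)" and card: "card T + 1 = card V"
    using assms unfolding multigraph_def spanning_tree_def is_tree_def connected_mg_iff_link by blast+
  have "\<exists>x y. f = {x, y}" if f: "f \<in> ends ` T" for f
  proof -
    obtain e where "e \<in> T" "f = ends e" using f by blast
    then show ?thesis using E[of e] by (auto simp: card_2_iff)
  qed
  then have "card V \<le> card (ends ` T) + 1" using fin conn by (intro linked_card_le) auto
  then have eq: "card (ends ` T) = card T" using card card_image_le[OF fin(2), of ends] by linarith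
  then show "inj_on ends T" using fin(2) eq_card_imp_inj_on by blast
  show "pair_tree V (ends ` T)" unfolding pair_tree_def using fin(1) E conn card eq by auto
qed

text \<open>If the ends of \<open>e\<close> were preserved as a set, then \<open>sE e\<close> and
  \<open>e\<close> would be edges of the same tree with the same ends, hence equal. Here the absence
  of fixed edges enters.\<close>

lemma (in involution) sym_tree_of_decomposition:
  assumes "multigraph V E ends" "spanning_tree V E ends T" "sE ` T = T"
    and "\<And>v. v \<in> V \<Longrightarrow> s v \<in> V" "\<And>e. e \<in> T \<Longrightarrow> ends (sE e) = s ` ends e \<and> sE e \<noteq> e"
  shows "sym_tree V (ends ` T)"
proof -
  have "s ` ends e \<in> ends ` T \<and> s ` ends e \<noteq> ends e" if "e \<in> T" for e
  proof -
    have "sE e \<in> T" using assms(3) that by blast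
    then show ?thesis using assms(5)[OF that] inj_onD[OF spanning_tree_pairs(1)[OF assms(1,2)], of "sE e" e] that
      by (metis image_eqI)
  qed
  then show ?thesis unfolding sym_tree_def using spanning_tree_pairs(2)[OF assms(1,2)] assms(4) by blast
qed

section \<open>Colours as signs of products\<close>

lemma mem_framework_colours:
  "1 \<in> framework_colours x y \<longleftrightarrow> \<bar>(x - y) $ 2\<bar> \<le> \<bar>(x - y) $ 1\<bar>"
  "2 \<in> framework_colours x y \<longleftrightarrow> \<bar>(x - y) $ 1\<bar> \<le> \<bar>(x - y) $ 2\<bar>"
  by (auto simp: framework_colours_def infnorm_2 inner_axis max_def)

text \<open>Compare squares: they differ by \<open>4 * a * b\<close>.\<close>

lemma abs_add_le_abs_diff_iff: "\<bar>a + b\<bar> \<le> \<bar>a - b\<bar> \<longleftrightarrow> a * b \<le> (0 :: real)"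
  and abs_diff_le_abs_add_iff: "\<bar>a - b\<bar> \<le> \<bar>a + b\<bar> \<longleftrightarrow> 0 \<le> a * b"
  unfolding abs_le_square_iff by (simp_all add: power2_eq_square algebra_simps)

theorem theorem5p10:
  fixes V :: "'v set" and E :: "'e set" and ends :: "'e \<Rightarrow> 'v set"
    and T1 T2 :: "'e set" and sV :: "'v \<Rightarrow> 'v" and sE :: "'e \<Rightarrow> 'e"
  assumes "in_G2sym V E ends T1 T2 sV sE"
    and "\<not> is_K1 V E ends T1 T2 sV sE"
  shows "\<exists>p \<tau>. Cs_realisation V E ends T1 T2 sV p \<tau>"
proof -
  have "sym_two_tree_decomp V E ends T1 T2 sV sE" and nofix: "\<And>e. e \<in> E \<Longrightarrow> sE e \<noteq> e"
    using assms by (auto simp: in_G2sym_def)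
  then have mg: "multigraph V E ends" and st: "spanning_tree V E ends T1" "spanning_tree V E ends T2"
    and E: "T1 \<union> T2 = E" "T1 \<inter> T2 = {}" and sT: "sE ` T1 = T1" "sE ` T2 = T2"
    and bij: "bij_betw sV V V" and sV: "\<And>v. v \<in> V \<Longrightarrow> sV (sV v) = v"
    and sE: "\<And>e. e \<in> E \<Longrightarrow> ends (sE e) = sV ` ends e"
    unfolding sym_two_tree_decomp_def two_tree_decomp_def Z2_symmetric_def mg_automorphism_def
    by blast+
  have sV_mem: "sV v \<in> V" if "v \<in> V" for v using bij that by (auto simp: bij_betw_def)
  define s where "s v = (if v \<in> V then sV v else v)" for v
  interpret involution s by unfold_locales (simp add: s_def sV sV_mem)
  have s_mem: "s v \<in> V" if "v \<in> V" for v using that by (simp add: s_def sV_mem)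
  have s_ends: "ends (sE e) = s ` ends e \<and> sE e \<noteq> e" if "e \<in> E" for e
  proof -
    have "ends e \<subseteq> V" using mg that by (auto simp: multigraph_def)
    then have "sV ` ends e = s ` ends e" by (intro image_cong) (auto simp: s_def)
    then show ?thesis using sE[OF that] nofix[OF that] by simp
  qed
  let ?P1 = "ends ` T1" and ?P2 = "ends ` T2"
  have tree: "sym_tree V ?P1" "sym_tree V ?P2"
    using sym_tree_of_decomposition[OF mg st(1) sT(1) s_mem s_ends]
      sym_tree_of_decomposition[OF mg st(2) sT(2) s_mem s_ends] E(1) by blast+
  \<comment> \<open>Every half of the parallel pairs admits a drawing, so any transversal of the
    orbits will do.\<close>
  have "finite (?P1 \<inter> ?P2)" using pair_treeD(6)[OF sym_treeD(1)[OF tree(1)]] by blast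
  moreover have "s ` e \<in> ?P1 \<inter> ?P2 \<and> s ` e \<noteq> e \<and> s ` s ` e = e" if "e \<in> ?P1 \<inter> ?P2" for e
    using that sym_treeD(3,4)[OF tree(1), of e] sym_treeD(3)[OF tree(2), of e] by simp
  ultimately obtain F where F: "half F (?P1 \<inter> ?P2)"
    using involution_transversal[of "?P1 \<inter> ?P2" "(`) s"] unfolding half_def by blast
  obtain u where u: "generic V F u" "signs 1 (?P2 - ?P1) u" "signs (- 1) (?P1 - ?P2) u"
    using sym_trees_realisable[OF tree, of 1] F unfolding realisable_def by blast
  \<comment> \<open>The point (\<open>u v\<close>, \<open>u (s v)\<close>) rotated by 45 degrees and
    scaled by the square root of 2. Applying \<open>s\<close> swaps the two values, which negates
    the first coordinate only.\<close>
  define p :: "'v \<Rightarrow> real^2" where "p v = vector [u v - u (s v), u v + u (s v)]" for v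
  define \<tau> :: "real^2 \<Rightarrow> real^2" where "\<tau> x = (\<chi> j. if j = 1 then - (x $ j) else x $ j)" for x
  define \<kappa> :: "'e \<Rightarrow> 2" where "\<kappa> e = (if e \<in> T1 then 1 else 2)" for e
  have "inj_on p V"
  proof (rule inj_onI, rule ccontr)
    fix v w assume vw: "v \<in> V" "w \<in> V" "p v = p w" "v \<noteq> w"
    have "p v $ 1 = p w $ 1" "p v $ 2 = p w $ 2" using vw(3) by simp_all
    then have "u v - u (s v) = u w - u (s w)" "u v + u (s v) = u w + u (s w)"
      by (simp_all add: p_def)
    then show False using generic_separates[OF tree(1) F _ u(1) vw(1,2,4)] by auto
  qed
  have refl: "\<tau> (p v) = p (sV v)" if "v \<in> V" for v
    using that by (simp add: vec_eq_iff forall_2 \<tau>_def p_def s_def sV sV_mem)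
  have diff: "(p v - p w) $ 1 = (u v - u w) - (u (s v) - u (s w))"
    "(p v - p w) $ 2 = (u v - u w) + (u (s v) - u (s w))" for v w
    by (simp_all add: p_def)
  have colours: "1 \<in> framework_colours (p v) (p w) \<longleftrightarrow> {v, w} \<in> ?P1"
    "2 \<in> framework_colours (p v) (p w) \<longleftrightarrow> {v, w} \<in> ?P2"
    if "{v, w} \<in> ?P1 \<union> ?P2" for v w
  proof -
    \<comment> \<open>The colours depend on the sign of \<open>?d\<close> alone. It vanishes on
      parallel pairs because \<open>F\<close> aligns either the pair or its mirror image, and
      \<open>?d\<close> is the same for both.\<close>
    let ?d = "(u v - u w) * (u (s v) - u (s w))"
    have "?d < 0" if "{v, w} \<in> ?P1 - ?P2" using signsD[OF u(3) that] by simp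
    moreover have "0 < ?d" if "{v, w} \<in> ?P2 - ?P1" using signsD[OF u(2) that] by simp
    moreover have "?d = 0" if vw: "{v, w} \<in> ?P1 \<inter> ?P2"
    proof -
      have V: "v \<in> V" "w \<in> V" using pair_treeD(7)[OF sym_treeD(1)[OF tree(1)], of v w] vw by auto
      have "F \<union> (`) s ` F = ?P1 \<inter> ?P2" using F by (simp add: half_def)
      then have "{v, w} \<in> F \<union> (`) s ` F" using vw by (simp only:)
      then obtain f where "f \<in> F" "{v, w} = f \<or> {v, w} = s ` f" by blast
      then have "{v, w} \<in> F \<or> {s v, s w} \<in> F" by (metis image_s_s image_insert image_empty)
      then show ?thesis using u(1) V s_mem link_edge[of v w F] link_edge[of "s v" "s w" F]
        by (auto simp: generic_def)
    qed
    ultimately have "?d \<le> 0 \<longleftrightarrow> {v, w} \<in> ?P1" "0 \<le> ?d \<longleftrightarrow> {v, w} \<in> ?P2"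
      using that by (smt (verit) DiffI IntI UnE)+
    then show "1 \<in> framework_colours (p v) (p w) \<longleftrightarrow> {v, w} \<in> ?P1"
      "2 \<in> framework_colours (p v) (p w) \<longleftrightarrow> {v, w} \<in> ?P2"
      unfolding mem_framework_colours diff abs_add_le_abs_diff_iff abs_diff_le_abs_add_iff by auto
  qed
  have bij_\<kappa>: "bij_betw \<kappa> (edges_between E ends v w) (framework_colours (p v) (p w))"
    if ne: "edges_between E ends v w \<noteq> {}" for v w
    unfolding bij_betw_def
  proof
    have "{v, w} \<in> ?P1 \<union> ?P2" using ne E(1) by (auto simp: edges_between_def)
    note col = colours[OF this]
    show "inj_on \<kappa> (edges_between E ends v w)"
    proof (rule inj_onI)
      fix e f assume ef: "e \<in> edges_between E ends v w" "f \<in> edges_between E ends v w" "\<kappa> e = \<kappa> f"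
      then have "e \<in> T1 \<and> f \<in> T1 \<or> e \<in> T2 \<and> f \<in> T2" "ends e = ends f"
        using E(1) by (auto simp: edges_between_def \<kappa>_def split: if_splits)
      then show "e = f" using spanning_tree_pairs(1)[OF mg st(1)] spanning_tree_pairs(1)[OF mg st(2)]
        by (auto dest: inj_onD)
    qed
    have "1 \<in> \<kappa> ` edges_between E ends v w \<longleftrightarrow> {v, w} \<in> ?P1"
      using E by (auto simp: edges_between_def \<kappa>_def image_iff)
    moreover have "2 \<in> \<kappa> ` edges_between E ends v w \<longleftrightarrow> {v, w} \<in> ?P2"
      using E by (auto simp: edges_between_def \<kappa>_def image_iff)
    \<comment> \<open>Both colour sets contain 1 or 2 exactly when the corresponding tree joins
      \<open>v\<close> and \<open>w\<close>.\<close>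
    ultimately have "k \<in> \<kappa> ` edges_between E ends v w \<longleftrightarrow> k \<in> framework_colours (p v) (p w)" for k
      using exhaust_2[of k] col by metis
    then show "\<kappa> ` edges_between E ends v w = framework_colours (p v) (p w)" by blast
  qed
  have "well_positioned V E ends p" "framework_colouring V E ends p \<kappa>"
    unfolding well_positioned_def framework_colouring_def
    using bij_\<kappa> bij_betw_same_card[OF bij_\<kappa>] by simp_all
  moreover have "{e \<in> E. \<kappa> e = 1} = T1" "{e \<in> E. \<kappa> e = 2} = T2" using E by (auto simp: \<kappa>_def)
  ultimately have "realisation V E ends T1 T2 p"
    using \<open>inj_on p V\<close> unfolding realisation_def by blast
  moreover have "coord_axis_reflection \<tau>"
    unfolding coord_axis_reflection_def \<tau>_def by (intro exI[of _ 1]) simp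
  ultimately show ?thesis using \<open>inj_on p V\<close> refl unfolding Cs_realisation_def by blast
qed

end
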